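(* Let $m\ge 1$ and let $G=(g_1,\ldots,g_m)\in\mathcal{R}^m$ be a list of nonzero polynomials. The following are equivalent. (A) $G$ is a Gröbner basis with respect to $\prec$. (B) For every $i,j$ such that $1\le i<j\le m$, at least one of the following holds: (B0) $S_{\prec}(g_i,g_j)$ reduces to zero with respect to $G$. (B1) $\mathrm{lt}_{\prec}(g_i)$ and $\mathrm{lt}_{\prec}(g_j)$ are relatively prime. (B2) There exist indices $k_1,\ldots,k_r\in\{1,\ldots,m\}$ such that $i=k_1$, $j=k_r$, each $\mathrm{lt}_{\prec}(g_{k_\ell})$ ($1\le\ell\le r$) divides $\mathrm{lcm}(\mathrm{lt}_{\prec}(g_i),\mathrm{lt}_{\prec}(g_j))$, and each $S_{\prec}(g_{k_\ell},g_{k_{\ell+1}})$ ($1\le\ell\le r-1$) reduces to zero with respect to $G$. (B3) There exist indices $k_1,\ldots,k_r\in\{1,\ldots,m\}$ such that $i=k_1$, $j=k_r$, the list of leading terms $(\mathrm{lt}_{\prec}(g_{k_1}),\ldots,\mathrm{lt}_{\prec}(g_{k_r}))$ satisfies the Extended Criterion, and each $S_{\prec}(g_{k_\ell},g_{k_{\ell+1}})$ ($1\le\ell\le r-1$) reduces to zero with respect to $G'=(g_{k_1},\ldots,g_{k_r})$.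
   Context: $\mathcal{R}=\mathbb{F}[x_1,\ldots,x_n]$ is a commutative polynomial ring over a field $\mathbb{F}$. A monomial is a nonzero scalar times a product of powers of the variables; a term is a monomial with coefficient $1$. $\prec$ is a fixed admissible term ordering (monomial order) on the terms of $\mathcal{R}$. For nonzero $p\in\mathcal{R}$, $\mathrm{lt}_{\prec}(p)$ is its leading term (with coefficient $1$) and $\mathrm{lc}_{\prec}(p)$ its leading coefficient. A term is "a term of $p$" if it occurs in $p$ with nonzero coefficient. Gröbner basis: $G=(g_1,\ldots,g_m)$ is a Gröbner basis with respect to $\prec$ if for every nonzero $p$ in the ideal generated by $G$ there is some $g\in G$ with $\mathrm{lt}_{\prec}(g)\mid\mathrm{lt}_{\prec}(p)$. $S$-polynomial: $\sigma_{f,g}=\mathrm{lcm}(\mathrm{lt}_{\prec}(f),\mathrm{lt}_{\prec}(g))/\mathrm{lt}_{\prec}(f)$ and $S_{\prec}(f,g)=\mathrm{lc}_{\prec}(g)\,\sigma_{f,g}\,f-\mathrm{lc}_{\prec}(f)\,\sigma_{g,f}\,g$, for nonzero $f,g\in\mathcal{R}$. Reduction to zero: $p\in\mathcal{R}$ reduces to zero with respect to $G=(g_1,\ldots,g_m)$ if $p=0$ or there exist monomials $q_1,\ldots,q_s$ and indices $\nu_1,\ldots,\nu_s\in\{1,\ldots,m\}$ such that $p=q_1g_{\nu_1}+\cdots+q_sg_{\nu_s}$; $\mathrm{lt}_{\prec}(q_1)\mathrm{lt}_{\prec}(g_{\nu_1})$ is a term of $p$; and for each $i>1$, $\mathrm{lt}_{\prec}(q_i)\mathrm{lt}_{\prec}(g_{\nu_i})$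 is a term of $p-q_1g_{\nu_1}-\cdots-q_{i-1}g_{\nu_{i-1}}$. Extended Criterion: a list of terms $(t_1,\ldots,t_r)$ satisfies the Extended Criterion if (EDiv) for every $k$ with $1\le k\le r$, $\gcd(t_1,t_r)$ divides $t_k$; and (EVar) for every variable $x$, either $\deg_x\gcd(t_1,t_r)=0$ or the sequence $(\deg_x t_k)_{k=1}^r$ is monotonic (weakly increasing or weakly decreasing). *)

theory Defs
  imports Complex_Main "HOL-Library.Poly_Mapping"
begin

text \<open>
  Terms are represented by their exponent vectors, so the product of two terms is the sum of their
  exponent vectors and the term 1 is the vector 0.  The variables are the elements of a finite
  type \<open>'x\<close>.  The coefficient of \<open>p\<close> at \<open>t\<close> is \<open>lookup p t\<close>, and the terms of \<open>p\<close> are the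
  elements of \<open>keys p\<close>.
\<close>

type_synonym 'x pp = "'x \<Rightarrow>\<^sub>0 nat"
type_synonym ('x, 'a) mpoly = "'x pp \<Rightarrow>\<^sub>0 'a"

definition is_monomial :: "('x, 'a::zero) mpoly \<Rightarrow> bool" where
  "is_monomial p \<longleftrightarrow> (\<exists>t c. c \<noteq> 0 \<and> p = Poly_Mapping.single t c)"

definition term_dvd :: "'x pp \<Rightarrow> 'x pp \<Rightarrow> bool" where
  "term_dvd s t \<longleftrightarrow> (\<exists>u. t = s + u)"

lift_definition term_lcm :: "'x pp \<Rightarrow> 'x pp \<Rightarrow> 'x pp" is "\<lambda>s t x. max (s x) (t x)"
proof -
  fix s t :: "'x \<Rightarrow> nat"
  assume "finite {x. s x \<noteq> 0}" "finite {x. t x \<noteq> 0}"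
  then have "finite ({x. s x \<noteq> 0} \<union> {x. t x \<noteq> 0})" by simp
  then show "finite {x. max (s x) (t x) \<noteq> 0}" by (rule rev_finite_subset) auto
qed

lift_definition term_gcd :: "'x pp \<Rightarrow> 'x pp \<Rightarrow> 'x pp" is "\<lambda>s t x. min (s x) (t x)"
proof -
  fix s t :: "'x \<Rightarrow> nat"
  assume "finite {x. s x \<noteq> 0}"
  then show "finite {x. min (s x) (t x) \<noteq> 0}" by (rule rev_finite_subset) auto
qed

definition relatively_prime :: "'x pp \<Rightarrow> 'x pp \<Rightarrow> bool" where
  "relatively_prime s t \<longleftrightarrow> term_gcd s t = 0"

definition admissible_order :: "('x pp \<Rightarrow> 'x pp \<Rightarrow> bool) \<Rightarrow> bool" where
  "admissible_order prec \<longleftrightarrow>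
     irreflp prec \<and> transp prec \<and> totalp prec \<and>
     (\<forall>t. t \<noteq> 0 \<longrightarrow> prec 0 t) \<and>
     (\<forall>s t u. prec s t \<longrightarrow> prec (s + u) (t + u))"

text \<open>The leading term and leading coefficient are meaningful for nonzero polynomials only.\<close>

definition lt :: "('x pp \<Rightarrow> 'x pp \<Rightarrow> bool) \<Rightarrow> ('x, 'a::zero) mpoly \<Rightarrow> 'x pp" where
  "lt prec p = (THE t. t \<in> Poly_Mapping.keys p \<and> (\<forall>s\<in>Poly_Mapping.keys p. s \<noteq> t \<longrightarrow> prec s t))"

definition lc :: "('x pp \<Rightarrow> 'x pp \<Rightarrow> bool) \<Rightarrow> ('x, 'a::zero) mpoly \<Rightarrow> 'a" where
  "lc prec p = Poly_Mapping.lookup p (lt prec p)"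

text \<open>\<open>module.span (*) B\<close> is the ideal generated by \<open>B\<close>.\<close>

definition is_groebner_basis ::
    "('x pp \<Rightarrow> 'x pp \<Rightarrow> bool) \<Rightarrow> ('x, 'a::field) mpoly list \<Rightarrow> bool" where
  "is_groebner_basis prec G \<longleftrightarrow>
     (\<forall>p\<in>module.span (*) (set G). p \<noteq> 0 \<longrightarrow> (\<exists>g\<in>set G. term_dvd (lt prec g) (lt prec p)))"

text \<open>The subtraction in \<open>spoly_cofactor\<close> is the exact division of terms lcm(lt f, lt g) / lt f.\<close>

definition spoly_cofactor ::
    "('x pp \<Rightarrow> 'x pp \<Rightarrow> bool) \<Rightarrow> ('x, 'a::field) mpoly \<Rightarrow> ('x, 'a) mpoly \<Rightarrow> 'x pp" where
  "spoly_cofactor prec f g = term_lcm (lt prec f) (lt prec g) - lt prec f"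

definition spoly ::
    "('x pp \<Rightarrow> 'x pp \<Rightarrow> bool) \<Rightarrow> ('x, 'a::field) mpoly \<Rightarrow> ('x, 'a) mpoly \<Rightarrow> ('x, 'a) mpoly" where
  "spoly prec f g =
     Poly_Mapping.single (spoly_cofactor prec f g) (lc prec g) * f -
     Poly_Mapping.single (spoly_cofactor prec g f) (lc prec f) * g"

text \<open>
  For \<open>i = 1\<close> the inner sum is empty.  List positions start at 0, so \<open>\<nu> i < length G\<close> says that
  \<open>\<nu> i\<close> is an index of \<open>G\<close>.  No cancellation of terms is required in the individual steps.
\<close>

definition reduces_to_zero ::
    "('x pp \<Rightarrow> 'x pp \<Rightarrow> bool) \<Rightarrow> ('x, 'a::field) mpoly list \<Rightarrow> ('x, 'a) mpoly \<Rightarrow> bool" where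
  "reduces_to_zero prec G p \<longleftrightarrow>
     p = 0 \<or>
     (\<exists>(s::nat) q \<nu>.
        (\<forall>i\<in>{1..s}. is_monomial (q i) \<and> \<nu> i < length G) \<and>
        p = (\<Sum>i=1..s. q i * G ! \<nu> i) \<and>
        (\<forall>i\<in>{1..s}. lt prec (q i) + lt prec (G ! \<nu> i)
                      \<in> Poly_Mapping.keys (p - (\<Sum>j=1..<i. q j * G ! \<nu> j))))"

text \<open>Meaningful for nonempty lists only.\<close>

definition extended_criterion :: "'x pp list \<Rightarrow> bool" where
  "extended_criterion ts \<longleftrightarrow>
     (\<forall>t\<in>set ts. term_dvd (term_gcd (hd ts) (last ts)) t) \<and>
     (\<forall>x. Poly_Mapping.lookup (term_gcd (hd ts) (last ts)) x = 0 \<or>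
          sorted_wrt (\<le>) (map (\<lambda>t. Poly_Mapping.lookup t x) ts) \<or>
          sorted_wrt (\<ge>) (map (\<lambda>t. Poly_Mapping.lookup t x) ts))"

end

theory Submission
  imports Defs "HOL-Computational_Algebra.Polynomial"
begin

text \<open>
  A Groebner basis reduces every polynomial of its ideal to zero: cancel leading terms, which
  terminates because a monomial order is well-founded (\<open>Dickson\<close>, \<open>prec_wf\<close>). This gives (B0)
  for every pair.

  For the converse, fix a term \<open>w\<close> and scale each \<open>g\<close> whose leading term divides \<open>w\<close> by a monomial
  so that the product \<open>monic_at g w\<close> has leading term \<open>w\<close> and leading coefficient 1. Call \<open>f\<close> and
  \<open>g\<close> linked at \<open>w\<close> if \<open>monic_at f w - monic_at g w\<close> is a sum of monomial multiples of basis elements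
  whose leading terms are all below \<open>w\<close>. For \<open>w\<close> the lcm of the two leading terms the difference is
  the S-polynomial up to a nonzero constant. Being linked is an equivalence relation that is
  inherited by the multiples of \<open>w\<close>. If all pairs are linked at their lcm, then modulo sums of
  multiples below \<open>w\<close> only one class of \<open>monic_at g w\<close> is left, so a polynomial represented by
  multiples up to \<open>w\<close> either has leading term \<open>w\<close> or is represented below \<open>w\<close>. Well-founded
  induction gives the Groebner property (\<open>linked_lt_dvd\<close>). It remains to see that each of the four
  conditions links \<open>f = g_i\<close> and \<open>g = g_j\<close>. Condition (B0) does so directly, and (B2) by transitivity.

  Conditions (B1) and (B3) rest on one observation (\<open>linked_common_factor\<close>): if \<open>f = p * u\<close> and
  \<open>g = p * v\<close> where \<open>u\<close> and \<open>v\<close> have relatively prime leading terms, then \<open>v * f = u * g\<close>,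
  and separating the leading terms of \<open>v\<close> and \<open>u\<close> from their tails turns this into a link of \<open>f\<close>
  and \<open>g\<close>. For (B1) take \<open>p = 1\<close>. For (B3) take \<open>p\<close> a greatest common divisor, which exists as the
  polynomial ring is factorial (\<open>mpoly_cofactors\<close>); one has to show that no variable \<open>x\<close> divides both
  leading terms. If \<open>x\<close> does not divide the gcd of the leading terms of \<open>f\<close> and \<open>g\<close>, this is clear.
  Otherwise, the exponents of \<open>x\<close> are monotonic along the path from \<open>f\<close> to \<open>g\<close>, say increasing. The
  S-polynomials of neighbours on the path, which reduce to zero over the path alone, are syzygies of
  the polynomials on the path. Eliminating the inner polynomials one after another leaves a syzygy
  \<open>a * f = b * g\<close>, and because the exponents increase, every factor that the elimination introduces
  has a leading term free of \<open>x\<close>, so that \<open>x\<close> does not divide the leading term of \<open>b\<close>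
  (\<open>increasing_syzygy\<close>). But \<open>u\<close> divides \<open>b\<close> since \<open>u * a = v * b\<close>, so \<open>x\<close> does not divide the
  leading term of \<open>u\<close>. For decreasing exponents reverse the path.
\<close>

section \<open>Factorial domains as subsets of a ring\<close>

text \<open>
  The induction on the number of variables runs through polynomial rings that are not types, so
  divisibility, units and primes are taken relative to a subset of a ring.
\<close>

definition subdomain :: "'r::comm_ring_1 set \<Rightarrow> bool" where
  "subdomain A \<longleftrightarrow> 0 \<in> A \<and> 1 \<in> A \<and> (\<forall>a\<in>A. \<forall>b\<in>A. a + b \<in> A \<and> a - b \<in> A \<and> a * b \<in> A \<and>
     (a * b = 0 \<longrightarrow> a = 0 \<or> b = 0))"

definition divides_in :: "'r::comm_ring_1 set \<Rightarrow> 'r \<Rightarrow> 'r \<Rightarrow> bool" where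
  "divides_in A a b \<longleftrightarrow> (\<exists>c\<in>A. b = a * c)"

definition unit_in :: "'r::comm_ring_1 set \<Rightarrow> 'r \<Rightarrow> bool" where
  "unit_in A u \<longleftrightarrow> u \<in> A \<and> divides_in A u 1"

definition prime_in :: "'r::comm_ring_1 set \<Rightarrow> 'r \<Rightarrow> bool" where
  "prime_in A p \<longleftrightarrow> p \<in> A \<and> p \<noteq> 0 \<and> \<not> unit_in A p \<and>
     (\<forall>a\<in>A. \<forall>b\<in>A. divides_in A p (a * b) \<longrightarrow> divides_in A p a \<or> divides_in A p b)"

text \<open>
  The number of primes is recorded as a measure for inductions; it counts factors with multiplicity.
\<close>

inductive prime_product :: "'r::comm_ring_1 set \<Rightarrow> nat \<Rightarrow> 'r \<Rightarrow> bool" for A where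
  unit: "unit_in A u \<Longrightarrow> prime_product A 0 u"
| mult: "prime_in A p \<Longrightarrow> prime_product A n a \<Longrightarrow> prime_product A (Suc n) (p * a)"

lemma prime_in_divides:
  "prime_in A p \<Longrightarrow> divides_in A p (a * b) \<Longrightarrow> a \<in> A \<Longrightarrow> b \<in> A \<Longrightarrow> divides_in A p a \<or> divides_in A p b"
  by (simp add: prime_in_def)

definition factorial_in :: "'r::comm_ring_1 set \<Rightarrow> bool" where
  "factorial_in A \<longleftrightarrow> subdomain A \<and> (\<forall>a\<in>A. a \<noteq> 0 \<longrightarrow> (\<exists>n. prime_product A n a))"

definition coeffs_in :: "'r::comm_ring_1 set \<Rightarrow> 'r poly set" where
  "coeffs_in A = {P. \<forall>i. coeff P i \<in> A}"

text \<open>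
  Only constants of the coefficient domain are tested, so this is the usual condition that the
  content is a unit.
\<close>

definition primitive :: "'r::comm_ring_1 set \<Rightarrow> 'r poly \<Rightarrow> bool" where
  "primitive A P \<longleftrightarrow> P \<in> coeffs_in A \<and> P \<noteq> 0 \<and> (\<forall>p. prime_in A p \<longrightarrow> \<not> divides_in (coeffs_in A) [:p:] P)"

context
  fixes A :: "'r::comm_ring_1 set"
  assumes A: "subdomain A"
begin

lemma subdomain_closed: "0 \<in> A" "1 \<in> A" "a \<in> A \<Longrightarrow> b \<in> A \<Longrightarrow> a + b \<in> A" "a \<in> A \<Longrightarrow> b \<in> A \<Longrightarrow> a - b \<in> A"
  "a \<in> A \<Longrightarrow> b \<in> A \<Longrightarrow> a * b \<in> A"
  using A by (auto simp: subdomain_def)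

lemma subdomain_mult_neq_0: "a \<in> A \<Longrightarrow> b \<in> A \<Longrightarrow> a \<noteq> 0 \<Longrightarrow> b \<noteq> 0 \<Longrightarrow> a * b \<noteq> 0"
  using A by (auto simp: subdomain_def)

lemma subdomain_sum: "(\<And>i. i \<in> I \<Longrightarrow> f i \<in> A) \<Longrightarrow> sum f I \<in> A"
  by (induction I rule: infinite_finite_induct) (auto intro: subdomain_closed)

lemma cancel_in: "a \<in> A \<Longrightarrow> b \<in> A \<Longrightarrow> c \<in> A \<Longrightarrow> a \<noteq> 0 \<Longrightarrow> a * b = a * c \<Longrightarrow> b = c"
  using subdomain_mult_neq_0[of a "b - c"] subdomain_closed(4)[of b c] by (auto simp: algebra_simps)

lemma divides_in_mult: "a \<in> A \<Longrightarrow> c \<in> A \<Longrightarrow> divides_in A a b \<Longrightarrow> divides_in A a (b * c)"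
  unfolding divides_in_def using subdomain_closed(5) by (metis mult.assoc)

lemma divides_in_triv: "c \<in> A \<Longrightarrow> divides_in A a (a * c)"
  unfolding divides_in_def by auto

lemma divides_in_trans: "divides_in A a b \<Longrightarrow> divides_in A b c \<Longrightarrow> divides_in A a c"
  unfolding divides_in_def using subdomain_closed(5) by (metis mult.assoc)

lemma divides_in_add: "divides_in A a b \<Longrightarrow> divides_in A a c \<Longrightarrow> divides_in A a (b + c)"
  unfolding divides_in_def using subdomain_closed(3) by (metis distrib_left)

lemma divides_in_diff: "divides_in A a b \<Longrightarrow> divides_in A a c \<Longrightarrow> divides_in A a (b - c)"
  unfolding divides_in_def using subdomain_closed(4) by (metis right_diff_distrib)

lemma unit_in_nz: "unit_in A u \<Longrightarrow> u \<noteq> 0"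
  by (auto simp: unit_in_def divides_in_def)

lemma unit_in_multD:
  assumes "a \<in> A" "b \<in> A" "unit_in A (a * b)" shows "unit_in A a" "unit_in A b"
proof -
  obtain v where v: "v \<in> A" "1 = a * b * v" using assms(3) by (auto simp: unit_in_def divides_in_def)
  have "1 = a * (b * v)" "1 = b * (a * v)" using v by (simp_all add: algebra_simps)
  then show "unit_in A a" "unit_in A b"
    using v(1) assms(1,2) subdomain_closed(5) unfolding unit_in_def divides_in_def by metis+
qed

lemma unit_in_mult: "unit_in A a \<Longrightarrow> unit_in A b \<Longrightarrow> unit_in A (a * b)"
proof -
  assume a: "unit_in A a" "unit_in A b"
  then obtain v w where v: "v \<in> A" "1 = a * v" "w \<in> A" "1 = b * w" by (auto simp: unit_in_def divides_in_def)
  have "1 = (a * v) * (b * w)" using v by simp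
  then have "1 = a * b * (v * w)" by (simp add: algebra_simps)
  then show ?thesis using a v(1,3) subdomain_closed(5) unfolding unit_in_def divides_in_def by blast
qed

lemma prime_product_mem: "prime_product A n a \<Longrightarrow> a \<in> A \<and> a \<noteq> 0"
proof (induction rule: prime_product.induct)
  case (unit u) then show ?case using unit_in_nz by (auto simp: unit_in_def)
next
  case (mult p n a) then show ?case using subdomain_closed(5) subdomain_mult_neq_0 by (auto simp: prime_in_def)
qed

lemma prime_product_unit_mult: "prime_product A n a \<Longrightarrow> unit_in A u \<Longrightarrow> prime_product A n (u * a)"
proof (induction rule: prime_product.induct)
  case (unit v) then show ?case using unit_in_mult by (auto intro: prime_product.unit)
next
  case (mult p n a)
  then have "prime_product A (Suc n) (p * (u * a))" by (auto intro: prime_product.mult)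
  then show ?case by (simp add: algebra_simps)
qed

lemma prime_product_mult: "prime_product A n a \<Longrightarrow> prime_product A m b \<Longrightarrow> prime_product A (n + m) (a * b)"
proof (induction rule: prime_product.induct)
  case (unit v) then show ?case using prime_product_unit_mult by simp
next
  case (mult p n a)
  then have "prime_product A (Suc (n+m)) (p * (a * b))" by (auto intro: prime_product.mult)
  then show ?case by (simp add: algebra_simps)
qed

text \<open>
  Each prime of the product divides one of the two factors and can be cancelled there.
\<close>

lemma prime_product_split:
  "prime_product A n c \<Longrightarrow> a \<in> A \<Longrightarrow> b \<in> A \<Longrightarrow> c = a * b \<Longrightarrow>
    \<exists>i j. prime_product A i a \<and> prime_product A j b \<and> i + j = n"
proof (induction arbitrary: a b rule: prime_product.induct)
  case (unit u)
  then have "prime_product A 0 a" "prime_product A 0 b" using unit_in_multD by (auto intro: prime_product.unit)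
  then show ?case by auto
next
  case (mult p n c)
  have p: "p \<in> A" "p \<noteq> 0" using mult by (auto simp: prime_in_def)
  have c: "c \<in> A" using mult prime_product_mem by blast
  have "divides_in A p (a * b)" using mult.prems(3) c by (metis divides_in_def)
  then consider "divides_in A p a" | "divides_in A p b" using prime_in_divides[OF mult.hyps(1)] mult.prems(1,2) by blast
  then show ?case
  proof cases
    case 1
    then obtain a' where a: "a' \<in> A" "a = p * a'" by (auto simp: divides_in_def)
    have "c = a' * b" using cancel_in[of p c "a' * b"] p c a mult.prems subdomain_closed(5) by (simp add: mult.assoc)
    then obtain i j where "prime_product A i a'" "prime_product A j b" "i + j = n" using mult.IH a mult.prems by blast
    then show ?thesis using a mult.hyps by (intro exI[of _ "Suc i"] exI[of _ j]) (auto intro: prime_product.mult)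
  next
    case 2
    then obtain b' where b: "b' \<in> A" "b = p * b'" by (auto simp: divides_in_def)
    have "c = a * b'" using cancel_in[of p c "a * b'"] p c b mult.prems subdomain_closed(5) by (simp add: algebra_simps)
    then obtain i j where "prime_product A i a" "prime_product A j b'" "i + j = n" using mult.IH b mult.prems by blast
    then show ?thesis using b mult.hyps by (intro exI[of _ i] exI[of _ "Suc j"]) (auto intro: prime_product.mult)
  qed
qed

section \<open>Polynomials over a factorial domain\<close>

lemma coeffs_in_lead: assumes "P \<in> coeffs_in A" "Q \<in> coeffs_in A" "P \<noteq> 0" "Q \<noteq> 0"
  shows "P * Q \<noteq> 0" "degree (P * Q) = degree P + degree Q" "lead_coeff (P * Q) = lead_coeff P * lead_coeff Q"
proof -
  have "lead_coeff P * lead_coeff Q \<noteq> 0" using assms subdomain_mult_neq_0 by (auto simp: coeffs_in_def)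
  then have c: "coeff (P * Q) (degree P + degree Q) \<noteq> 0" by (simp add: coeff_mult_degree_sum)
  then show d: "P * Q \<noteq> 0" "degree (P * Q) = degree P + degree Q"
    using le_degree[OF c] degree_mult_le[of P Q] by auto
  show "lead_coeff (P * Q) = lead_coeff P * lead_coeff Q" using d by (simp add: coeff_mult_degree_sum)
qed

lemma coeffs_in_subdomain: "subdomain (coeffs_in A)"
proof -
  have "P * Q \<in> coeffs_in A" if "P \<in> coeffs_in A" "Q \<in> coeffs_in A" for P Q
    using that by (auto simp: coeffs_in_def coeff_mult intro!: subdomain_sum subdomain_closed)
  moreover have "0 \<in> coeffs_in A" "1 \<in> coeffs_in A" using subdomain_closed by (auto simp: coeffs_in_def coeff_pCons one_pCons split: nat.splits)
  moreover have "P + Q \<in> coeffs_in A" "P - Q \<in> coeffs_in A" if "P \<in> coeffs_in A" "Q \<in> coeffs_in A" for P Q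
    using that subdomain_closed by (auto simp: coeffs_in_def)
  moreover have "P = 0 \<or> Q = 0" if "P \<in> coeffs_in A" "Q \<in> coeffs_in A" "P * Q = 0" for P Q
    using that coeffs_in_lead(1) by blast
  ultimately show ?thesis unfolding subdomain_def by simp
qed

lemma coeffs_in_const: "[:a:] \<in> coeffs_in A \<longleftrightarrow> a \<in> A"
  using subdomain_closed(1) by (auto simp: coeffs_in_def coeff_pCons split: nat.splits)

lemma coeffs_in_smult: "a \<in> A \<Longrightarrow> P \<in> coeffs_in A \<Longrightarrow> smult a P \<in> coeffs_in A"
  using subdomain_closed(5) by (auto simp: coeffs_in_def)

lemma coeffs_in_monom: "a \<in> A \<Longrightarrow> monom a n \<in> coeffs_in A"
  using subdomain_closed(1) by (auto simp: coeffs_in_def)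

lemma coeffs_in_lc: "P \<in> coeffs_in A \<Longrightarrow> coeff P n \<in> A"
  by (auto simp: coeffs_in_def)

end

lemmas coeffs_in_closed = subdomain_closed[OF coeffs_in_subdomain]

context
  fixes A :: "'r::comm_ring_1 set"
  assumes A: "subdomain A"
begin

text \<open>
  Division with remainder over a domain that is not a field: the dividend is first multiplied by a
  power of the leading coefficient of the divisor.
\<close>

lemma pseudo_div:
  assumes "H \<in> coeffs_in A" "H \<noteq> 0"
  shows "F \<in> coeffs_in A \<Longrightarrow> \<exists>c\<in>A. \<exists>Q\<in>coeffs_in A. \<exists>R\<in>coeffs_in A. c \<noteq> 0 \<and> smult c F = Q * H + R \<and> (R = 0 \<or> degree R < degree H)"
proof (induction "if F = 0 then 0 else Suc (degree F)" arbitrary: F rule: less_induct)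
  case less
  note pm = coeffs_in_closed[OF A]
  show ?case
  proof (cases "F = 0 \<or> degree F < degree H")
    case True
    then show ?thesis using pm(1) less.prems subdomain_closed(2)[OF A]
      by (intro bexI[of _ 1] bexI[of _ 0] bexI[of _ F]) auto
  next
    case False
    let ?l = "lead_coeff H" and ?M = "monom (lead_coeff F) (degree F - degree H)"
    let ?F = "smult ?l F - ?M * H"
    have l: "?l \<in> A" "?l \<noteq> 0" "lead_coeff F \<in> A" "lead_coeff F \<noteq> 0" using assms less.prems False by (auto intro: coeffs_in_lc[OF A])
    have M: "?M \<in> coeffs_in A" using l coeffs_in_monom[OF A] by auto
    have F: "?F \<in> coeffs_in A" using pm coeffs_in_smult[OF A] l M less.prems assms by auto
    have "degree (?M * H) \<le> degree F"
      using degree_mult_le[of ?M H] degree_monom_le[of "lead_coeff F" "degree F - degree H"] False by linarith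
    then have d: "degree ?F \<le> degree F" by (intro degree_diff_le) (auto intro: order_trans[OF degree_smult_le])
    have "degree ?M = degree F - degree H" using l by (simp add: degree_monom_eq)
    then have "coeff (?M * H) (degree F) = lead_coeff F * ?l"
      using coeff_mult_degree_sum[of ?M H] False by simp
    then have "coeff ?F (degree F) = 0" by (simp add: mult.commute)
    then have "?F = 0 \<or> degree ?F < degree F" using eq_zero_or_degree_less[OF d] by auto
    then have "(if ?F = 0 then 0 else Suc (degree ?F)) < (if F = 0 then 0 else Suc (degree F))"
      using False by (simp only: if_False split: if_split) auto
    from less.hyps[OF this F] obtain c Q R
      where r: "c \<in> A" "Q \<in> coeffs_in A" "R \<in> coeffs_in A" "c \<noteq> 0" "smult c ?F = Q * H + R" "R = 0 \<or> degree R < degree H"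
      by blast
    have "smult (c * ?l) F = (Q + smult c ?M) * H + R" using r(5) by (simp add: algebra_simps smult_diff_right)
    moreover have "c * ?l \<in> A" "c * ?l \<noteq> 0" using r l subdomain_closed[OF A] subdomain_mult_neq_0[OF A] by auto
    moreover have "Q + smult c ?M \<in> coeffs_in A" using r M pm coeffs_in_smult[OF A] by auto
    ultimately show ?thesis using r by blast
  qed
qed

text \<open>
  Gauss's lemma. A prime constant that divides \<open>F * G\<close> divides the product of the leading
  coefficients, hence one of them. Subtracting that leading monomial preserves the hypothesis and
  lowers the degree.
\<close>

lemma prime_const:
  assumes "prime_in A p" shows "prime_in (coeffs_in A) [:p:]"
proof -
  note pm = coeffs_in_closed[OF A]
  note B = coeffs_in_subdomain[OF A]
  have p: "p \<in> A" "p \<noteq> 0" "\<not> unit_in A p" using assms by (auto simp: prime_in_def)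
  have pp: "[:p:] \<in> coeffs_in A" using p coeffs_in_const[OF A] by auto
  have u: "\<not> unit_in (coeffs_in A) [:p:]"
  proof
    assume "unit_in (coeffs_in A) [:p:]"
    then obtain V where V: "V \<in> coeffs_in A" "1 = [:p:] * V" unfolding unit_in_def divides_in_def by blast
    have "1 = p * coeff V 0" using arg_cong[OF V(2), of "\<lambda>P. coeff P 0"] by simp
    then show False using p coeffs_in_lc[OF A V(1)] unfolding unit_in_def divides_in_def by blast
  qed
  have step: "divides_in (coeffs_in A) [:p:] F \<or> divides_in (coeffs_in A) [:p:] G"
    if "F \<in> coeffs_in A" "G \<in> coeffs_in A" "divides_in (coeffs_in A) [:p:] (F * G)" for F G
    using that
  proof (induction "(if F = 0 then 0 else Suc (degree F)) + (if G = 0 then 0 else Suc (degree G))" arbitrary: F G rule: less_induct)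
    case less
    show ?case
    proof (cases "F = 0 \<or> G = 0")
      case True
      then show ?thesis using pm(1) unfolding divides_in_def by (metis mult_zero_right)
    next
      case False
      have red: "divides_in (coeffs_in A) [:p:] F \<or> divides_in (coeffs_in A) [:p:] G"
        if FG: "F \<in> coeffs_in A" "G \<in> coeffs_in A" "divides_in (coeffs_in A) [:p:] (F * G)" "F \<noteq> 0" "divides_in A p (lead_coeff F)"
          and IH: "\<And>F'. F' \<in> coeffs_in A \<Longrightarrow> F' = 0 \<or> degree F' < degree F \<Longrightarrow> divides_in (coeffs_in A) [:p:] (F' * G) \<Longrightarrow>
             divides_in (coeffs_in A) [:p:] F' \<or> divides_in (coeffs_in A) [:p:] G" for F G
      proof -
        obtain y where y: "y \<in> A" "lead_coeff F = p * y" using FG by (auto simp: divides_in_def)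
        let ?M = "monom (lead_coeff F) (degree F)"
        have M: "?M = [:p:] * monom y (degree F)" by (simp add: y smult_monom)
        have dM: "divides_in (coeffs_in A) [:p:] ?M" unfolding M using coeffs_in_monom[OF A y(1)] divides_in_triv[OF B] by blast
        have Mp: "?M \<in> coeffs_in A" using FG coeffs_in_lc[OF A] coeffs_in_monom[OF A] by blast
        have "degree (F - ?M) \<le> degree F" by (intro degree_diff_le) (auto simp: degree_monom_le)
        then have "F - ?M = 0 \<or> degree (F - ?M) < degree F" using eq_zero_or_degree_less[of "F - ?M" "degree F"] by simp
        moreover have "divides_in (coeffs_in A) [:p:] ((F - ?M) * G)"
          using divides_in_diff[OF B FG(3) divides_in_mult[OF B pp FG(2) dM]] by (simp add: algebra_simps)
        ultimately have "divides_in (coeffs_in A) [:p:] (F - ?M) \<or> divides_in (coeffs_in A) [:p:] G" using IH pm(4)[OF FG(1) Mp] by blast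
        then show ?thesis using divides_in_add[OF B _ dM, of "F - ?M"] by auto
      qed
      obtain W where W: "W \<in> coeffs_in A" "F * G = [:p:] * W" using less.prems(3) unfolding divides_in_def by blast
      have FG0: "F * G \<noteq> 0" using coeffs_in_lead[OF A less.prems(1,2)] False by auto
      then have "W \<noteq> 0" using W by auto
      then have "lead_coeff F * lead_coeff G = p * lead_coeff W"
        using coeffs_in_lead(3)[OF A less.prems(1,2)] coeffs_in_lead(3)[OF A pp W(1)] p(2) False
        by (simp add: W(2) del: mult_pCons_left)
      then have "divides_in A p (lead_coeff F * lead_coeff G)" using coeffs_in_lc[OF A W(1)] by (auto simp: divides_in_def)
      then consider "divides_in A p (lead_coeff F)" | "divides_in A p (lead_coeff G)"
        using prime_in_divides[OF assms] coeffs_in_lc[OF A] less.prems(1,2) by blast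
      then show ?thesis
      proof cases
        case 1
        show ?thesis 
        proof (rule red[OF less.prems _ 1])
          fix F' assume "F' \<in> coeffs_in A" "F' = 0 \<or> degree F' < degree F" "divides_in (coeffs_in A) [:p:] (F' * G)"
          then show "divides_in (coeffs_in A) [:p:] F' \<or> divides_in (coeffs_in A) [:p:] G"
            using less.hyps[of F' G] less.prems(2) False by auto
        qed (use False in simp)
      next
        case 2
        have "divides_in (coeffs_in A) [:p:] G \<or> divides_in (coeffs_in A) [:p:] F"
        proof (rule red[OF less.prems(2,1) _ _ 2])
          fix F' assume "F' \<in> coeffs_in A" "F' = 0 \<or> degree F' < degree G" "divides_in (coeffs_in A) [:p:] (F' * F)"
          then show "divides_in (coeffs_in A) [:p:] F' \<or> divides_in (coeffs_in A) [:p:] F"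
            using less.hyps[of F F'] less.prems(1) False by (auto simp: mult.commute[of F])
        qed (use False less.prems(3) in \<open>auto simp: mult.commute[of G]\<close>)
        then show ?thesis by blast
      qed
    qed
  qed
  show ?thesis unfolding prime_in_def using step p u pp by auto
qed

lemma prime_product_const: "prime_product A n a \<Longrightarrow> prime_product (coeffs_in A) n [:a:]"
proof (induction rule: prime_product.induct)
  case (unit u)
  then obtain v where "v \<in> A" "1 = u * v" "u \<in> A" by (auto simp: unit_in_def divides_in_def)
  then have "[:v:] \<in> coeffs_in A" "[:u:] \<in> coeffs_in A" "1 = [:u:] * [:v:]" using coeffs_in_const[OF A] by (auto simp: one_pCons mult.commute)
  then have "unit_in (coeffs_in A) [:u:]" unfolding unit_in_def divides_in_def by blast
  then show ?case by (rule prime_product.unit)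
next
  case (mult p n a)
  have "[:p * a:] = [:p:] * [:a:]" by simp
  then show ?case using prime_product.mult[OF prime_const[OF mult(1)] mult.IH] by metis
qed

text \<open>
  The primes of the constant are moved one at a time into \<open>Q\<close> or \<open>H\<close>; the degrees stay the same
  as constants have degree 0.
\<close>

lemma cancel_const_split:
  "prime_product A n c \<Longrightarrow> P \<in> coeffs_in A \<Longrightarrow> Q \<in> coeffs_in A \<Longrightarrow> H \<in> coeffs_in A \<Longrightarrow> H \<noteq> 0 \<Longrightarrow> smult c P = Q * H \<Longrightarrow>
    \<exists>Q'\<in>coeffs_in A. \<exists>H'\<in>coeffs_in A. P = Q' * H' \<and> divides_in (coeffs_in A) H' H \<and> degree H' = degree H"
proof (induction arbitrary: Q H rule: prime_product.induct)
  case (unit u)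
  then obtain v where v: "v \<in> A" "1 = u * v" by (auto simp: unit_in_def divides_in_def)
  have "P = smult (u * v) P" using v by simp
  also have "\<dots> = smult v (Q * H)" using unit by (metis mult.commute smult_smult)
  also have "\<dots> = smult v Q * H" by simp
  finally show ?case using v unit coeffs_in_smult[OF A] divides_in_triv[OF coeffs_in_subdomain[OF A] subdomain_closed(2)[OF coeffs_in_subdomain[OF A]], of H]
    by fastforce
next
  case (mult p n c)
  note B = coeffs_in_subdomain[OF A]
  have p: "prime_in (coeffs_in A) [:p:]" using prime_const mult by auto
  then have pm: "[:p:] \<in> coeffs_in A" "[:p:] \<noteq> 0" by (auto simp: prime_in_def)
  have c: "c \<in> A" using prime_product_mem[OF A] mult by blast
  have cP: "smult c P \<in> coeffs_in A" using c mult coeffs_in_smult[OF A] by auto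
  have eq: "[:p:] * smult c P = Q * H" using mult.prems by (simp add: mult.commute)
  have "divides_in (coeffs_in A) [:p:] (Q * H)" using cP eq by (metis divides_in_def)
  then consider "divides_in (coeffs_in A) [:p:] Q" | "divides_in (coeffs_in A) [:p:] H" 
    using prime_in_divides[OF p] mult.prems(2,3) by blast
  then show ?case
  proof cases
    case 1
    then obtain Q1 where Q1: "Q1 \<in> coeffs_in A" "Q = [:p:] * Q1" by (auto simp: divides_in_def)
    have "[:p:] * smult c P = [:p:] * (Q1 * H)" using eq Q1 by (simp only: mult.assoc)
    then have "smult c P = Q1 * H" using cancel_in[OF B pm(1) cP subdomain_closed(5)[OF B Q1(1) mult.prems(3)] pm(2)] by blast
    then show ?thesis using mult.IH Q1 mult.prems by blast
  next
    case 2
    then obtain H1 where H1: "H1 \<in> coeffs_in A" "H = [:p:] * H1" by (auto simp: divides_in_def)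
    have "[:p:] * smult c P = [:p:] * (Q * H1)" using eq H1 by (simp only: mult.left_commute)
    then have e: "smult c P = Q * H1" using cancel_in[OF B pm(1) cP subdomain_closed(5)[OF B mult.prems(2) H1(1)] pm(2)] by blast
    have "H1 \<noteq> 0" using H1 mult.prems by auto
    then have d: "degree H = degree H1" using coeffs_in_lead(2)[OF A pm(1) H1(1) pm(2)] H1(2) by (simp del: mult_pCons_left)
    obtain Q' H' where "Q' \<in> coeffs_in A" "H' \<in> coeffs_in A" "P = Q' * H'" "divides_in (coeffs_in A) H' H1" "degree H' = degree H1"
      using mult.IH[OF mult.prems(1,2) H1(1) \<open>H1 \<noteq> 0\<close> e] by blast
    moreover have "divides_in (coeffs_in A) H1 H" using H1 pm by (auto simp: divides_in_def intro!: bexI[of _ "[:p:]"])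
    ultimately show ?thesis using divides_in_trans[OF B] d by metis
  qed
qed

text \<open>
  By Gauss's lemma, a prime of the constant divides \<open>P\<close> or the cofactor \<open>W\<close>, and \<open>P\<close> is excluded
  by primitivity.
\<close>

lemma cancel_const_primitive:
  "prime_product A n c \<Longrightarrow> primitive A P \<Longrightarrow> W \<in> coeffs_in A \<Longrightarrow> G \<in> coeffs_in A \<Longrightarrow> smult c G = P * W \<Longrightarrow> divides_in (coeffs_in A) P G"
proof (induction arbitrary: W rule: prime_product.induct)
  case (unit u)
  then obtain v where v: "v \<in> A" "1 = u * v" by (auto simp: unit_in_def divides_in_def)
  have "G = smult (u * v) G" using v by simp
  also have "\<dots> = smult v (P * W)" using unit by (metis mult.commute smult_smult)
  also have "\<dots> = P * smult v W" by simp
  finally show ?case using v unit coeffs_in_smult[OF A] unfolding divides_in_def by blast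
next
  case (mult p n c)
  note B = coeffs_in_subdomain[OF A]
  have p: "prime_in (coeffs_in A) [:p:]" using prime_const mult by auto
  then have pm: "[:p:] \<in> coeffs_in A" "[:p:] \<noteq> 0" by (auto simp: prime_in_def)
  have P: "P \<in> coeffs_in A" using mult by (auto simp: primitive_def)
  have c: "c \<in> A" using prime_product_mem[OF A] mult by blast
  have cG: "smult c G \<in> coeffs_in A" using c mult coeffs_in_smult[OF A] by auto
  have eq: "[:p:] * smult c G = P * W" using mult.prems by (simp add: mult.commute)
  have "divides_in (coeffs_in A) [:p:] (P * W)" using cG eq by (metis divides_in_def)
  then have "divides_in (coeffs_in A) [:p:] W" 
    using prime_in_divides[OF p _ P mult.prems(2)] mult by (auto simp: primitive_def)
  then obtain W1 where W1: "W1 \<in> coeffs_in A" "W = [:p:] * W1" by (auto simp: divides_in_def)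
  have "[:p:] * smult c G = [:p:] * (P * W1)" using eq W1 by (simp only: mult.left_commute)
  then have "smult c G = P * W1" using cancel_in[OF B pm(1) cG subdomain_closed(5)[OF B P W1(1)] pm(2)] by blast
  then show ?case using mult W1 by blast
qed

context
  assumes fact: "\<And>a. a \<in> A \<Longrightarrow> a \<noteq> 0 \<Longrightarrow> \<exists>n. prime_product A n a"
begin

lemma primitive_const_factor:
  assumes "primitive A P" "P = Q * H" "Q \<in> coeffs_in A" "H \<in> coeffs_in A" "degree Q = 0" shows "unit_in (coeffs_in A) Q"
proof -
  obtain a where a: "Q = [:a:]" using assms(5) degree_eq_zeroE by blast
  have "a \<in> A" using a assms coeffs_in_const[OF A] by auto
  moreover have "a \<noteq> 0" using a assms by (auto simp: primitive_def)
  ultimately obtain n where n: "prime_product A n a" using fact by blast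
  then show ?thesis
  proof cases
    case unit
    then show ?thesis using prime_product_const[OF n] a prime_product.cases by fastforce
  next
    case (mult p m b)
    have b: "b \<in> A" using mult prime_product_mem[OF A] by blast
    have "P = [:p:] * smult b H" using assms(2) a mult by (simp add: mult.commute)
    then have "divides_in (coeffs_in A) [:p:] P" using coeffs_in_smult[OF A b assms(4)] unfolding divides_in_def by blast
    then show ?thesis using assms mult by (auto simp: primitive_def)
  qed
qed

text \<open>
  The polynomials over \<open>A\<close> need not form a principal ideal domain, but they do so up to constants.
  Suppose that \<open>P\<close> divides \<open>F * G\<close>. A polynomial \<open>H\<close> of least degree in the ideal generated by \<open>P\<close> and \<open>F\<close> divides
  constant multiples of both, by pseudo-division. If \<open>H\<close> is a constant, then \<open>P\<close> divides a constant
  multiple of \<open>G\<close>; otherwise irreducibility makes \<open>P\<close> a divisor of \<open>H\<close> and so of a constant multiple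
  of \<open>F\<close>. The constants are cancelled by primitivity.
\<close>

lemma primitive_irreducible_prime:
  assumes "primitive A P" "degree P > 0"
    and irr: "\<And>Q H. Q \<in> coeffs_in A \<Longrightarrow> H \<in> coeffs_in A \<Longrightarrow> P = Q * H \<Longrightarrow> degree Q = 0 \<or> degree H = 0"
  shows "prime_in (coeffs_in A) P"
proof -
  note B = coeffs_in_subdomain[OF A]
  note pm = subdomain_closed[OF B]
  have P: "P \<in> coeffs_in A" "P \<noteq> 0" using assms by (auto simp: primitive_def)
  have u: "\<not> unit_in (coeffs_in A) P"
  proof
    assume "unit_in (coeffs_in A) P"
    then obtain V where V: "V \<in> coeffs_in A" "1 = P * V" by (auto simp: unit_in_def divides_in_def)
    then have "V \<noteq> 0" by auto
    then have "degree (P * V) > 0" using coeffs_in_lead(2)[OF A P(1) V(1) P(2)] assms by simp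
    then show False using V by (metis degree_1 less_irrefl)
  qed
  have step: "divides_in (coeffs_in A) P G" if FG: "F \<in> coeffs_in A" "G \<in> coeffs_in A" "divides_in (coeffs_in A) P (F * G)" "\<not> divides_in (coeffs_in A) P F" for F G
  proof -
    let ?J = "\<lambda>H. H \<noteq> 0 \<and> (\<exists>U\<in>coeffs_in A. \<exists>V\<in>coeffs_in A. H = U * P + V * F)"
    \<comment> \<open>\<open>P\<close> itself shows that the ideal has nonzero elements\<close>
    have "P = 1 * P + 0 * F" by simp
    then have "?J P" using P(2) pm(1,2) by blast
    then obtain H where H: "?J H" and min: "\<And>H'. ?J H' \<Longrightarrow> degree H \<le> degree H'"
      using ex_has_least_nat[of ?J P degree] by blast
    then obtain U V where UV: "U \<in> coeffs_in A" "V \<in> coeffs_in A" "H = U * P + V * F" by blast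
    have Hm: "H \<in> coeffs_in A" using UV FG P pm by auto
    have div: "\<exists>c n. \<exists>Q\<in>coeffs_in A. prime_product A n c \<and> smult c K = Q * H"
      if K: "K \<in> coeffs_in A" "\<exists>U\<in>coeffs_in A. \<exists>V\<in>coeffs_in A. K = U * P + V * F" for K
    proof -
      obtain U' V' where UV': "U' \<in> coeffs_in A" "V' \<in> coeffs_in A" "K = U' * P + V' * F" using K by blast
      obtain c Q R where r: "c \<in> A" "Q \<in> coeffs_in A" "R \<in> coeffs_in A" "c \<noteq> 0" "smult c K = Q * H + R" "R = 0 \<or> degree R < degree H"
        using pseudo_div[OF Hm _ K(1)] H by blast
      have "R = smult c (U' * P + V' * F) - Q * (U * P + V * F)" using r UV UV' by (simp add: algebra_simps)
      also have "\<dots> = (smult c U' - Q * U) * P + (smult c V' - Q * V) * F"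
        by (simp add: algebra_simps smult_add_right)
      finally have R: "R = \<dots>" .
      have "smult c U' - Q * U \<in> coeffs_in A" "smult c V' - Q * V \<in> coeffs_in A"
        using r(1,2) UV(1,2) UV'(1,2) pm(4,5) coeffs_in_smult[OF A] by auto
      then have "?J R" if "R \<noteq> 0" using that R by blast
      then have "R = 0" using min[of R] r(6) by (meson leD)
      moreover obtain n where "prime_product A n c" using fact r(1,4) by blast
      ultimately show ?thesis using r(2,5) by auto
    qed
    have "P = 1 * P + 0 * F" "F = 0 * P + 1 * F" by simp_all
    then have JJ: "\<exists>U\<in>coeffs_in A. \<exists>V\<in>coeffs_in A. P = U * P + V * F" "\<exists>U\<in>coeffs_in A. \<exists>V\<in>coeffs_in A. F = U * P + V * F"
      using pm(1,2) by blast+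
    obtain n c Q where c: "prime_product A n c" "Q \<in> coeffs_in A" "smult c P = Q * H"
      using div[OF P(1) JJ(1)] by blast
    obtain n' c' Q' where c': "prime_product A n' c'" "Q' \<in> coeffs_in A" "smult c' F = Q' * H"
      using div[OF FG(1) JJ(2)] by blast
    show ?thesis
    proof (cases "degree H = 0")
      case True
      then obtain a where a: "H = [:a:]" using degree_eq_zeroE by blast
      then obtain m where m: "prime_product A m a" using H Hm fact coeffs_in_const[OF A] by fastforce
      obtain W where W: "W \<in> coeffs_in A" "F * G = P * W" using FG by (auto simp: divides_in_def)
      have UW: "U * G + V * W \<in> coeffs_in A" by (intro pm UV FG W)
      have "smult a G = H * G" using a by simp
      also have "\<dots> = U * P * G + V * (F * G)" using UV by (simp add: algebra_simps)
      also have "\<dots> = P * (U * G + V * W)" unfolding W by (simp add: algebra_simps)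
      finally show ?thesis by (rule cancel_const_primitive[OF m assms(1) UW FG(2)])
    next
      case False
      obtain Q1 H1 where q: "Q1 \<in> coeffs_in A" "H1 \<in> coeffs_in A" "P = Q1 * H1" "divides_in (coeffs_in A) H1 H" "degree H1 = degree H"
        using cancel_const_split[OF c(1) P(1) c(2) Hm _ c(3)] H by blast
      have "degree Q1 = 0" using irr[OF q(1,2,3)] q(5) False by auto
      then have "unit_in (coeffs_in A) Q1" using primitive_const_factor[OF assms(1) q(3,1,2)] by auto
      then obtain V1 where v: "V1 \<in> coeffs_in A" "1 = Q1 * V1" by (auto simp: unit_in_def divides_in_def)
      have "P * V1 = (Q1 * V1) * H1" unfolding q(3) by (simp only: mult.assoc mult.commute[of V1])
      then have "H1 = P * V1" using v(2) by simp
      then have "divides_in (coeffs_in A) P H1" using v(1) by (auto simp: divides_in_def)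
      then have "divides_in (coeffs_in A) P H" using divides_in_trans[OF B _ q(4)] by blast
      then obtain Z where Z: "Z \<in> coeffs_in A" "H = P * Z" by (auto simp: divides_in_def)
      have "smult c' F = P * (Q' * Z)" unfolding c'(3) Z by (simp add: algebra_simps)
      then have "divides_in (coeffs_in A) P F"
        by (rule cancel_const_primitive[OF c'(1) assms(1) pm(5)[OF c'(2) Z(1)] FG(1)])
      then show ?thesis using FG by blast
    qed
  qed
  show ?thesis unfolding prime_in_def using P u step by blast
qed

lemma prime_product_primitive: "primitive A P \<Longrightarrow> \<exists>n. prime_product (coeffs_in A) n P"
proof (induction "degree P" arbitrary: P rule: less_induct)
  case less
  note B = coeffs_in_subdomain[OF A]
  note pm = subdomain_closed[OF B]
  have P: "P \<in> coeffs_in A" "P \<noteq> 0" using less by (auto simp: primitive_def)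
  have part: "primitive A Q" if "P = Q * H" "Q \<in> coeffs_in A" "H \<in> coeffs_in A" for Q H
    using less.prems that divides_in_mult[OF B, of "[:_:]" H Q] coeffs_in_const[OF A]
    unfolding primitive_def prime_in_def by (metis mult_zero_left)
  show ?case
  proof (cases "\<exists>Q H. Q \<in> coeffs_in A \<and> H \<in> coeffs_in A \<and> P = Q * H \<and> degree Q \<noteq> 0 \<and> degree H \<noteq> 0")
    case True
    then obtain Q H where q: "Q \<in> coeffs_in A" "H \<in> coeffs_in A" "P = Q * H" "degree Q \<noteq> 0" "degree H \<noteq> 0" by blast
    have nz: "Q \<noteq> 0" "H \<noteq> 0" using q by auto
    have d: "degree P = degree Q + degree H" using coeffs_in_lead(2)[OF A q(1,2) nz] q by simp
    obtain n m where "prime_product (coeffs_in A) n Q" "prime_product (coeffs_in A) m H"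
      using less.hyps[of Q] less.hyps[of H] part[of Q H] part[of H Q] q d by (auto simp: mult.commute)
    then show ?thesis using prime_product_mult[OF B] q by blast
  next
    case False
    have one: "prime_product (coeffs_in A) 0 1" using pm by (intro prime_product.unit) (auto simp: unit_in_def divides_in_def)
    show ?thesis
    proof (cases "degree P = 0")
      case True
      then have "unit_in (coeffs_in A) P" using primitive_const_factor[OF less.prems, of P 1] P pm by auto
      then show ?thesis using prime_product.unit by blast
    next
      case nz: False
      then have "prime_in (coeffs_in A) P" using primitive_irreducible_prime[OF less.prems] False by blast
      then show ?thesis using prime_product.mult[OF _ one] by fastforce
    qed
  qed
qed

text \<open>
  Primes of the content are split off; the length of the factorization of the leading coefficient
  decreases each time.
\<close>

lemma prime_product_coeffs_in: "prime_product A n (lead_coeff P) \<Longrightarrow> P \<in> coeffs_in A \<Longrightarrow> \<exists>m. prime_product (coeffs_in A) m P"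
proof (induction n arbitrary: P rule: less_induct)
  case (less n)
  note B = coeffs_in_subdomain[OF A]
  have nz: "P \<noteq> 0" using prime_product_mem[OF A less.prems(1)] leading_coeff_0_iff by blast
  show ?case
  proof (cases "primitive A P")
    case True then show ?thesis using prime_product_primitive by blast
  next
    case False
    then obtain p where p: "prime_in A p" "divides_in (coeffs_in A) [:p:] P" using less nz by (auto simp: primitive_def)
    then obtain Q where Q: "Q \<in> coeffs_in A" "P = [:p:] * Q" by (auto simp: divides_in_def)
    have pp: "prime_in (coeffs_in A) [:p:]" using prime_const p by auto
    have "Q \<noteq> 0" using Q nz by auto
    then have "lead_coeff P = p * lead_coeff Q"
      using coeffs_in_lead(3)[OF A _ Q(1), of "[:p:]"] pp by (simp add: Q(2) prime_in_def del: mult_pCons_left)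
    then obtain i j where ij: "prime_product A i p" "prime_product A j (lead_coeff Q)" "i + j = n"
      using prime_product_split[OF A less.prems(1), of p "lead_coeff Q"] p coeffs_in_lc[OF A Q(1)] by (auto simp: prime_in_def)
    have "i \<noteq> 0" using ij(1) p(1) by (auto simp: prime_in_def elim: prime_product.cases)
    then obtain m where "prime_product (coeffs_in A) m Q" using less.IH[of j Q] ij Q by auto
    then show ?thesis using prime_product.mult[OF pp] Q by blast
  qed
qed

end
end

theorem factorial_in_coeffs_in:
  assumes "factorial_in A" shows "factorial_in (coeffs_in A)"
proof -
  have A: "subdomain A" using assms by (auto simp: factorial_in_def)
  have f: "\<exists>n. prime_product A n a" if "a \<in> A" "a \<noteq> 0" for a using assms that by (auto simp: factorial_in_def)
  have "\<exists>m. prime_product (coeffs_in A) m P" if P: "P \<in> coeffs_in A" "P \<noteq> 0" for P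
  proof -
    obtain n where "prime_product A n (lead_coeff P)"
      using f[OF coeffs_in_lc[OF A P(1)], of "degree P"] P(2) leading_coeff_0_iff by blast
    then show ?thesis using prime_product_coeffs_in[OF A f] P(1) by blast
  qed
  then show ?thesis using coeffs_in_subdomain[OF A] by (auto simp: factorial_in_def)
qed

section \<open>Polynomials in finitely many variables are factorial\<close>

context
  fixes A :: "'r::comm_ring_1 set" and \<phi> :: "'r \<Rightarrow> 's::comm_ring_1"
  assumes A: "factorial_in A"
    and add: "\<And>a b. \<phi> (a + b) = \<phi> a + \<phi> b" and times: "\<And>a b. \<phi> (a * b) = \<phi> a * \<phi> b" and one: "\<phi> 1 = 1"
    and ker: "\<And>a. a \<in> A \<Longrightarrow> \<phi> a = 0 \<Longrightarrow> a = 0"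
begin

lemma hom_diff: "\<phi> (a - b) = \<phi> a - \<phi> b"
  using add[of "a - b" b] by simp

lemma hom_zero: "\<phi> 0 = 0"
  using hom_diff[of 0 0] by simp

lemma subdomain_source: "subdomain A" using A by (simp add: factorial_in_def)

lemma hom_inj: "a \<in> A \<Longrightarrow> b \<in> A \<Longrightarrow> \<phi> a = \<phi> b \<Longrightarrow> a = b"
  using ker[of "a - b"] subdomain_closed(4)[OF subdomain_source] by (simp add: hom_diff)

lemma subdomain_image: "subdomain (\<phi> ` A)"
proof -
  note m = subdomain_closed[OF subdomain_source]
  have "0 \<in> \<phi> ` A" "1 \<in> \<phi> ` A" using m(1,2) one hom_zero by (metis imageI)+
  moreover have "\<phi> a + \<phi> b \<in> \<phi> ` A" "\<phi> a - \<phi> b \<in> \<phi> ` A" "\<phi> a * \<phi> b \<in> \<phi> ` A" if "a \<in> A" "b \<in> A" for a b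
    using m(3,4,5)[OF that] by (simp_all flip: add times hom_diff)
  moreover have "\<phi> a = 0 \<or> \<phi> b = 0" if "a \<in> A" "b \<in> A" "\<phi> a * \<phi> b = 0" for a b
    using ker[of "a * b"] m(5)[OF that(1,2)] subdomain_mult_neq_0[OF subdomain_source that(1,2)] that(3) hom_zero by (auto simp: times)
  ultimately show ?thesis unfolding subdomain_def by auto
qed

lemma divides_in_image: "a \<in> A \<Longrightarrow> b \<in> A \<Longrightarrow> divides_in (\<phi> ` A) (\<phi> a) (\<phi> b) \<longleftrightarrow> divides_in A a b"
  proof -
  assume ab: "a \<in> A" "b \<in> A"
  have "\<phi> b = \<phi> a * \<phi> c \<longleftrightarrow> b = a * c" if "c \<in> A" for c
    using hom_inj[OF ab(2) subdomain_closed(5)[OF subdomain_source ab(1) that]] times by metis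
  then show ?thesis by (simp add: divides_in_def)
qed

lemma unit_in_image: "a \<in> A \<Longrightarrow> unit_in (\<phi> ` A) (\<phi> a) \<longleftrightarrow> unit_in A a"
  using divides_in_image[of a 1] subdomain_closed(2)[OF subdomain_source] by (auto simp: unit_in_def one)

lemma prime_in_image: "prime_in A p \<Longrightarrow> prime_in (\<phi> ` A) (\<phi> p)"
  proof -
  assume p: "prime_in A p"
  then have pA: "p \<in> A" "p \<noteq> 0" "\<not> unit_in A p" by (auto simp: prime_in_def)
  have "divides_in (\<phi> ` A) (\<phi> p) (\<phi> a) \<or> divides_in (\<phi> ` A) (\<phi> p) (\<phi> b)"
    if ab: "a \<in> A" "b \<in> A" "divides_in (\<phi> ` A) (\<phi> p) (\<phi> a * \<phi> b)" for a b
    using prime_in_divides[OF p _ ab(1,2)] ab(3) divides_in_image[OF pA(1)] ab(1,2) subdomain_closed(5)[OF subdomain_source ab(1,2)]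
    by (metis times)
  moreover have "\<phi> p \<noteq> 0" using ker pA by blast
  ultimately show ?thesis using pA unit_in_image by (auto simp: prime_in_def)
qed

lemma prime_product_image: "prime_product A n a \<Longrightarrow> prime_product (\<phi> ` A) n (\<phi> a)"
proof (induction rule: prime_product.induct)
  case (unit u)
  then show ?case using unit_in_image[of u] by (intro prime_product.unit) (simp add: unit_in_def)
next
  case (mult p n a)
  then show ?case by (auto simp: times intro: prime_product.mult prime_in_image)
qed

lemma factorial_in_image: "factorial_in (\<phi> ` A)"
  using A subdomain_image prime_product_image hom_zero unfolding factorial_in_def by (metis imageE)

end

text \<open>
  The existence of a greatest common divisor \<open>p\<close>, stated through its cofactors: the last clause says
  that \<open>u\<close> and \<open>v\<close> have no common prime.
\<close>

lemma factorial_in_cofactors: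
  assumes A: "factorial_in A" and "f \<in> A" "f \<noteq> 0" "g \<in> A"
  shows "\<exists>p\<in>A. \<exists>u\<in>A. \<exists>v\<in>A. f = p * u \<and> g = p * v \<and> (\<forall>b\<in>A. divides_in A u (v * b) \<longrightarrow> divides_in A u b)"
proof -
  have sd: "subdomain A" using A by (simp add: factorial_in_def)
  note m = subdomain_closed[OF sd]
  obtain n where "prime_product A n f" using assms by (auto simp: factorial_in_def)
  then show ?thesis using \<open>g \<in> A\<close>
  proof (induction arbitrary: g rule: prime_product.induct)
    case (unit w)
    then obtain w' where w: "w' \<in> A" "1 = w * w'" "w \<in> A" by (auto simp: unit_in_def divides_in_def)
    have "divides_in A w b" if "b \<in> A" for b
    proof -
      have "b = w * (w' * b)" using w(2) by (simp add: mult.assoc[symmetric])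
      then show ?thesis using m(5)[OF w(1) that] unfolding divides_in_def by blast
    qed
    moreover have "w = 1 * w" "g = 1 * g" by simp_all
    ultimately show ?case using m(2) w(3) unit.prems by blast
  next
    case (mult q n a)
    have q: "q \<in> A" "q \<noteq> 0" using mult.hyps by (auto simp: prime_in_def)
    show ?case
    proof (cases "divides_in A q g")
      case True
      then obtain g' where g': "g' \<in> A" "g = q * g'" by (auto simp: divides_in_def)
      obtain p u v where *: "p \<in> A" "u \<in> A" "v \<in> A" "a = p * u" "g' = p * v"
        "\<forall>b\<in>A. divides_in A u (v * b) \<longrightarrow> divides_in A u b" using mult.IH[OF g'(1)] by blast
      have "q * a = q * p * u" "g = q * p * v" using *(4,5) g'(2) by (simp_all add: mult.assoc)
      then show ?thesis
        using *(2,3,6) m(5)[OF q(1) *(1)] by - (rule bexI[of _ "q * p", rotated], blast+)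
    next
      case False
      obtain p u v where *: "p \<in> A" "u \<in> A" "v \<in> A" "a = p * u" "g = p * v"
        "\<forall>b\<in>A. divides_in A u (v * b) \<longrightarrow> divides_in A u b" using mult.IH[OF mult.prems] by blast
      have nv: "\<not> divides_in A q v"
        using False divides_in_mult[OF sd q(1) *(1), of v] *(5) by (auto simp: mult.commute)
      have "divides_in A (q * u) b" if b: "b \<in> A" "divides_in A (q * u) (v * b)" for b
      proof -
        obtain z where z: "z \<in> A" "v * b = q * u * z" using b(2) by (auto simp: divides_in_def)
        have e: "v * b = u * (q * z)" using z(2) by (simp add: algebra_simps)
        have "divides_in A u (v * b)" unfolding e by (intro divides_in_triv[OF sd] m q z)
        then obtain b' where b': "b' \<in> A" "b = u * b'" using *(6) b(1) unfolding divides_in_def by blast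
        show ?thesis
        proof (cases "u = 0")
          case True
          then show ?thesis using b' m(1) by (auto simp: divides_in_def)
        next
          case u: False
          have "u * (v * b') = u * (q * z)" using e b'(2) by (simp add: algebra_simps)
          then have "v * b' = q * z" using cancel_in[OF sd *(2) m(5)[OF *(3) b'(1)] m(5)[OF q(1) z(1)] u] by blast
          then have "divides_in A q (v * b')" using z(1) by (auto simp: divides_in_def)
          then have "divides_in A q b'" using prime_in_divides[OF mult.hyps(1)] nv *(3) b'(1) by blast
          then obtain c where "c \<in> A" "b' = q * c" by (auto simp: divides_in_def)
          then have "c \<in> A" "b = q * u * c" using b' by (simp_all add: algebra_simps)
          then show ?thesis unfolding divides_in_def by blast
        qed
      qed
      moreover have "q * a = p * (q * u)" using *(4) by (simp add: algebra_simps)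
      ultimately show ?thesis
        using *(1,3,5) m(5)[OF q(1) *(2)] by - (rule bexI[of _ p, rotated], blast+)
    qed
  qed
qed

lemma lookup_single_mult: "Poly_Mapping.lookup (Poly_Mapping.single s c * p) (s + t) = c * Poly_Mapping.lookup p t"
  for p :: "'x pp \<Rightarrow>\<^sub>0 'a::comm_semiring_1"
proof -
  have "Poly_Mapping.lookup (Poly_Mapping.single s c * p) (s + t) =
    Sum_any (\<lambda>l. (c when s = l) * Sum_any (\<lambda>q. Poly_Mapping.lookup p q when s + t = l + q))"
    by (simp add: lookup_mult lookup_single)
  also have "\<dots> = Sum_any (\<lambda>l. c * Sum_any (\<lambda>q. Poly_Mapping.lookup p q when s + t = l + q) when s = l)"
    by (simp add: when_mult)
  also have "\<dots> = c * Poly_Mapping.lookup p t" by simp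
  finally show ?thesis .
qed

lemma keys_single_mult: "Poly_Mapping.keys (Poly_Mapping.single s c * p) \<subseteq> (+) s ` Poly_Mapping.keys p"
  for p :: "'x pp \<Rightarrow>\<^sub>0 'a::comm_semiring_1"
proof
  fix t assume "t \<in> Poly_Mapping.keys (Poly_Mapping.single s c * p)"
  then obtain a b where "t = a + b" "a \<in> Poly_Mapping.keys (Poly_Mapping.single s c)" "b \<in> Poly_Mapping.keys p"
    using keys_mult by blast
  then show "t \<in> (+) s ` Poly_Mapping.keys p" by (auto split: if_splits)
qed

lemma sum_monomials: "p = (\<Sum>t\<in>Poly_Mapping.keys p. Poly_Mapping.single t (Poly_Mapping.lookup p t))"
  by (rule poly_mapping_eqI) (simp add: lookup_sum lookup_single when_def, simp add: in_keys_iff)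

definition polys_in :: "'x set \<Rightarrow> ('x, 'a::comm_ring_1) mpoly set" where
  "polys_in X = {p. \<forall>t\<in>Poly_Mapping.keys p. Poly_Mapping.keys t \<subseteq> X}"

lemma polys_in_closed:
  fixes p q :: "('x, 'a::comm_ring_1) mpoly"
  assumes "p \<in> polys_in X" "q \<in> polys_in X"
  shows "p + q \<in> polys_in X" "p - q \<in> polys_in X" "p * q \<in> polys_in X"
proof -
  show "p + q \<in> polys_in X" using assms Poly_Mapping.keys_add[of p q] by (auto simp: polys_in_def)
  show "p - q \<in> polys_in X" using assms keys_diff[of p q] by (auto simp: polys_in_def)
  show "p * q \<in> polys_in X"
    unfolding polys_in_def
  proof clarify
    fix t x assume t: "t \<in> Poly_Mapping.keys (p * q)" "x \<in> Poly_Mapping.keys t"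
    then obtain a b where "t = a + b" "a \<in> Poly_Mapping.keys p" "b \<in> Poly_Mapping.keys q" using keys_mult by blast
    then show "x \<in> X" using assms t(2) Poly_Mapping.keys_add[of a b] by (fastforce simp: polys_in_def)
  qed
qed

abbreviation var :: "'x \<Rightarrow> ('x, 'a::comm_ring_1) mpoly" where
  "var x \<equiv> Poly_Mapping.single (Poly_Mapping.single x 1) 1"

lemma var_power: "Poly_Mapping.single (Poly_Mapping.single x (Suc 0)) 1 ^ n = Poly_Mapping.single (Poly_Mapping.single x n) (1::'a::comm_ring_1)"
  by (induction n) (simp_all add: mult_single flip: single_add)

text \<open>
  A variable \<open>x\<close> outside \<open>X\<close> is transcendental over the polynomials in \<open>X\<close>: the coefficient of
  \<open>x ^ i * t\<close> in \<open>P(x)\<close> is the coefficient of \<open>t\<close> in the \<open>i\<close>-th coefficient of \<open>P\<close>.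
\<close>

lemma poly_var_inj:
  assumes P: "P \<in> coeffs_in (polys_in X :: ('x, 'a::comm_ring_1) mpoly set)" and x: "x \<notin> X" and 0: "poly P (var x) = 0"
  shows "P = 0"
proof (rule poly_eqI, rule ccontr)
  fix i assume "coeff P i \<noteq> coeff 0 i"
  then have ne: "coeff P i \<noteq> 0" by simp
  then obtain t where t: "t \<in> Poly_Mapping.keys (coeff P i)" by (metis keys_eq_empty equals0I)
  have free: "Poly_Mapping.lookup u x = 0" if "u \<in> Poly_Mapping.keys (coeff P j)" for u j
    proof -
    have "coeff P j \<in> polys_in X" using P by (simp add: coeffs_in_def)
    then have "Poly_Mapping.keys u \<subseteq> X" using that by (simp add: polys_in_def)
    then show ?thesis using x by (auto simp: in_keys_iff)
  qed
  let ?m = "\<lambda>j. Poly_Mapping.single (Poly_Mapping.single x j) 1 * coeff P j"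
  have z: "Poly_Mapping.lookup (?m j) (Poly_Mapping.single x i + t) = 0" if "j \<noteq> i" for j
  proof (rule ccontr)
    assume "Poly_Mapping.lookup (?m j) (Poly_Mapping.single x i + t) \<noteq> 0"
    then have "Poly_Mapping.single x i + t \<in> Poly_Mapping.keys (?m j)" by (simp add: in_keys_iff)
    then obtain u where "Poly_Mapping.single x i + t = Poly_Mapping.single x j + u" "u \<in> Poly_Mapping.keys (coeff P j)"
      using keys_single_mult by blast
    then have "Poly_Mapping.lookup (Poly_Mapping.single x i + t) x = Poly_Mapping.lookup (Poly_Mapping.single x j + u) x" by simp
    then show False using that free[OF t] free[OF \<open>u \<in> _\<close>] by (simp add: lookup_add)
  qed
  have "0 = Poly_Mapping.lookup (poly P (var x)) (Poly_Mapping.single x i + t)" using 0 by simp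
  also have "\<dots> = (\<Sum>j\<le>degree P. Poly_Mapping.lookup (?m j) (Poly_Mapping.single x i + t))"
    by (simp add: poly_altdef var_power lookup_sum mult.commute)
  also have "\<dots> = Poly_Mapping.lookup (?m i) (Poly_Mapping.single x i + t)"
    using ne le_degree[of P i] z by (subst sum.remove[of _ i]) (auto intro: sum.neutral)
  also have "\<dots> = Poly_Mapping.lookup (coeff P i) t" by (simp add: lookup_single_mult)
  finally show False using t by (simp add: in_keys_iff)
qed

lemma subdomain_polys_in: "subdomain (polys_in X :: ('x, 'a::comm_ring_1) mpoly set) \<longleftrightarrow>
  (\<forall>p\<in>polys_in X. \<forall>q\<in>polys_in X. p * q = 0 \<longrightarrow> p = 0 \<or> (q :: ('x, 'a::comm_ring_1) mpoly) = 0)"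
proof -
  have "(0::('x, 'a) mpoly) \<in> polys_in X" "(1::('x, 'a) mpoly) \<in> polys_in X" by (auto simp: polys_in_def)
  then show ?thesis by (simp add: subdomain_def polys_in_closed)
qed

text \<open>
  Evaluation at a new variable identifies the univariate polynomials over \<open>polys_in X\<close> with
  \<open>polys_in (insert x X)\<close>, which carries factoriality from one to the other.
\<close>

lemma factorial_in_polys_in:
  assumes "finite X" shows "factorial_in (polys_in X :: ('x, 'a::field) mpoly set)"
  using assms
proof (induction X)
  case empty
  have c: "\<exists>c. p = Poly_Mapping.single 0 c" if "p \<in> polys_in {}" for p :: "('x, 'a) mpoly"
  proof -
    have "Poly_Mapping.keys p \<subseteq> {0}" using that by (auto simp: polys_in_def)
    then have "p = Poly_Mapping.single 0 (Poly_Mapping.lookup p 0)"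
      by (intro poly_mapping_eqI) (auto simp: lookup_single when_def in_keys_iff)
    then show ?thesis by blast
  qed
  have "subdomain (polys_in {} :: ('x, 'a) mpoly set)"
    unfolding subdomain_polys_in
  proof (intro ballI impI)
    fix p q :: "('x, 'a) mpoly" assume "p \<in> polys_in {}" "q \<in> polys_in {}" "p * q = 0"
    then show "p = 0 \<or> q = 0" using c[of p] c[of q]
      by (metis add.right_neutral lookup_single_eq lookup_zero mult_eq_0_iff mult_single single_zero)
  qed
  moreover have "\<exists>n. prime_product (polys_in {}) n p" if p: "p \<in> polys_in {}" "p \<noteq> 0" for p :: "('x, 'a) mpoly"
  proof -
    obtain c where pc: "p = Poly_Mapping.single 0 c" using c p by blast
    then have "c \<noteq> 0" using p by auto
    then have "1 = p * Poly_Mapping.single 0 (inverse c)" by (simp add: pc mult_single flip: single_one)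
    moreover have "Poly_Mapping.single 0 (inverse c) \<in> polys_in {}" by (auto simp: polys_in_def)
    ultimately have "unit_in (polys_in {}) p" using p unfolding unit_in_def divides_in_def by blast
    then show ?thesis using prime_product.unit by blast
  qed
  ultimately show ?case by (auto simp: factorial_in_def)
next
  case (insert x X)
  let ?\<phi> = "\<lambda>P. poly P (var x :: ('x, 'a) mpoly)"
  have F: "factorial_in (?\<phi> ` coeffs_in (polys_in X))"
    using insert by (intro factorial_in_image factorial_in_coeffs_in) (auto dest: poly_var_inj)
  then have S: "subdomain (?\<phi> ` coeffs_in (polys_in X))" by (simp add: factorial_in_def)
  have SX: "subdomain (polys_in X :: ('x, 'a) mpoly set)" using insert by (simp add: factorial_in_def)
  have "p \<in> ?\<phi> ` coeffs_in (polys_in X)" if p: "p \<in> polys_in (insert x X)" for p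
  proof -
    have "Poly_Mapping.single t c \<in> ?\<phi> ` coeffs_in (polys_in X)" if t: "Poly_Mapping.keys t \<subseteq> insert x X" for t c
    proof -
      \<comment> \<open>\<open>t = s * x ^ i\<close> with \<open>s\<close> free of \<open>x\<close>\<close>
      define i s where "i = Poly_Mapping.lookup t x" and "s = t - Poly_Mapping.single x i"
      have ts: "t = s + Poly_Mapping.single x i"
        by (rule poly_mapping_eqI) (auto simp: s_def i_def lookup_add lookup_minus lookup_single when_def)
      have "Poly_Mapping.lookup s x = 0" by (simp add: s_def i_def lookup_minus)
      then have "Poly_Mapping.keys s \<subseteq> X" using t
        by (auto simp: s_def i_def lookup_minus lookup_single when_def in_keys_iff subset_iff split: if_splits)
      then have "Poly_Mapping.single s c \<in> polys_in X" by (auto simp: polys_in_def)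
      then have "monom (Poly_Mapping.single s c) i \<in> coeffs_in (polys_in X)" by (rule coeffs_in_monom[OF SX])
      moreover have "Poly_Mapping.single t c = ?\<phi> (monom (Poly_Mapping.single s c) i)"
        by (simp add: poly_monom var_power mult_single ts)
      ultimately show ?thesis by blast
    qed
    then have "(\<Sum>t\<in>Poly_Mapping.keys p. Poly_Mapping.single t (Poly_Mapping.lookup p t)) \<in> ?\<phi> ` coeffs_in (polys_in X)"
      using p by (intro subdomain_sum[OF S]) (auto simp: polys_in_def)
    then show ?thesis using sum_monomials[of p] by simp
  qed
  moreover have "?\<phi> P \<in> polys_in (insert x X)" if P: "P \<in> coeffs_in (polys_in X)" for P
  proof -
    have "coeff P j * var x ^ j \<in> polys_in (insert x X)" for j
      using P by (intro polys_in_closed) (auto simp: polys_in_def coeffs_in_def var_power split: if_splits)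
    then have "(\<Sum>j\<in>J. coeff P j * var x ^ j) \<in> polys_in (insert x X)" for J
      proof (induction J rule: infinite_finite_induct)
      case (insert j J) then show ?case by (simp add: polys_in_closed(1))
    qed (simp_all add: polys_in_def)
    then show ?thesis by (simp add: poly_altdef)
  qed
  ultimately have "polys_in (insert x X) = ?\<phi> ` coeffs_in (polys_in X)" by blast
  then show ?case using F by simp
qed

text \<open>
  In a syzygy \<open>u * a = v * b\<close> of the cofactors, \<open>u\<close> must divide \<open>b\<close>. This is the only consequence of
  unique factorization that the criterion uses.
\<close>

theorem mpoly_cofactors:
  fixes f g :: "('x::finite, 'a::field) mpoly"
  assumes "f \<noteq> 0"
  obtains p u v where "f = p * u" "g = p * v" "\<And>a b. u * a = v * b \<Longrightarrow> u dvd b"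
proof -
  have U: "polys_in UNIV = (UNIV :: ('x, 'a) mpoly set)" by (auto simp: polys_in_def)
  have d: "divides_in (UNIV :: ('x, 'a) mpoly set) = (dvd)" by (auto simp: divides_in_def dvd_def fun_eq_iff)
  obtain p u v where "f = p * u" "g = p * v" "\<forall>b. u dvd (v * b) \<longrightarrow> u dvd b"
    using factorial_in_cofactors[of "polys_in UNIV" f g] factorial_in_polys_in[of "UNIV :: 'x set", where 'a='a] assms
    unfolding U d by auto
  then show thesis using that by (metis dvd_triv_left)
qed

section \<open>Terms and monomial orders\<close>

lemma module_times: "module ((*) :: 'r::comm_ring_1 \<Rightarrow> 'r \<Rightarrow> 'r)"
  by unfold_locales (simp_all add: algebra_simps)

lemma term_dvd_iff: "term_dvd s t \<longleftrightarrow> (\<forall>x. Poly_Mapping.lookup s x \<le> Poly_Mapping.lookup t x)"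
proof
  assume "\<forall>x. Poly_Mapping.lookup s x \<le> Poly_Mapping.lookup t x"
  then have "t = s + (t - s)" by (intro poly_mapping_eqI) (simp add: lookup_add lookup_minus)
  then show "term_dvd s t" unfolding term_dvd_def by blast
qed (auto simp: term_dvd_def lookup_add)

lemma term_dvd_diff: "term_dvd s t \<Longrightarrow> (t - s) + s = t"
  by (intro poly_mapping_eqI) (simp add: lookup_add lookup_minus term_dvd_iff)

lemma term_dvd_lcm: "term_dvd s (term_lcm s t)" "term_dvd t (term_lcm s t)"
  by (auto simp: term_dvd_iff term_lcm.rep_eq)

lemma term_lcm_commute: "term_lcm s t = term_lcm t s"
  by (intro poly_mapping_eqI) (simp add: term_lcm.rep_eq max.commute)

lemma increasing_subsequence:
  fixes f :: "nat \<Rightarrow> nat"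
  shows "\<exists>r. strict_mono r \<and> incseq (\<lambda>n. f (r n))"
proof -
  obtain r :: "nat \<Rightarrow> nat" where r: "strict_mono r" "monoseq (\<lambda>n. f (r n))" using seq_monosub by blast
  show ?thesis
  proof (cases "incseq (\<lambda>n. f (r n))")
    case False
    then have dec: "decseq (\<lambda>n. f (r n))" using r(2) by (simp add: monoseq_iff)
    obtain N where N: "\<And>n. f (r N) \<le> f (r n)" using ex_has_least_nat[of "\<lambda>_. True" _ "\<lambda>n. f (r n)"] by blast
    have "f (r (N + n)) = f (r N)" for n using N[of "N + n"] decseqD[OF dec, of N "N + n"] by simp
    moreover have "strict_mono (\<lambda>n. r (N + n))" using r(1) by (simp add: strict_mono_def)
    ultimately show ?thesis by (intro exI[of _ "\<lambda>n. r (N + n)"]) (simp add: incseq_def)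
  qed (use r in blast)
qed

text \<open>
  Passing to subsequences one variable at a time makes all exponents increasing at once.
\<close>

lemma Dickson:
  fixes f :: "nat \<Rightarrow> 'x::finite pp"
  shows "\<exists>i j. i < j \<and> term_dvd (f i) (f j)"
proof -
  have "\<exists>r. strict_mono r \<and> (\<forall>x\<in>X. incseq (\<lambda>n. Poly_Mapping.lookup (f (r n)) x))" if "finite X" for X
    using that
  proof (induction X)
    case empty
    show ?case by (intro exI[of _ id]) (simp add: strict_mono_def)
  next
    case (insert x X)
    then obtain r where r: "strict_mono r" "\<And>x. x \<in> X \<Longrightarrow> incseq (\<lambda>n. Poly_Mapping.lookup (f (r n)) x)" by blast
    obtain s where s: "strict_mono s" "incseq (\<lambda>n. Poly_Mapping.lookup (f (r (s n))) x)"
      using increasing_subsequence[of "\<lambda>n. Poly_Mapping.lookup (f (r n)) x"] by blast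
    have "incseq (\<lambda>n. Poly_Mapping.lookup (f (r (s n))) y)" if "y \<in> X" for y
      using r(2)[OF that] s(1) by (simp add: incseq_def strict_mono_less_eq)
    then show ?case using r(1) s by (intro exI[of _ "\<lambda>n. r (s n)"]) (auto simp: strict_mono_def)
  qed
  then obtain r where r: "strict_mono r" "\<And>x. incseq (\<lambda>n. Poly_Mapping.lookup (f (r n)) x)"
    by (metis UNIV_I finite_UNIV)
  have "r 0 < r 1" using r(1) by (simp add: strict_mono_def)
  moreover have "term_dvd (f (r 0)) (f (r 1))" using r(2) by (simp add: term_dvd_iff incseq_def)
  ultimately show ?thesis by blast
qed

lemma sum_first_last:
  fixes \<rho> :: "nat \<Rightarrow> 'b::comm_monoid_add"
  assumes "n \<ge> 1" "\<And>l. 0 < l \<Longrightarrow> l < n \<Longrightarrow> \<rho> l = 0"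
  shows "(\<Sum>l\<le>n. \<rho> l) = \<rho> 0 + \<rho> n"
proof -
  have "(\<Sum>l\<le>n. \<rho> l) = (\<Sum>l\<in>{0, n}. \<rho> l)"
    proof (rule sum.mono_neutral_right)
    show "\<forall>l\<in>{..n} - {0, n}. \<rho> l = 0" by (intro ballI assms(2)) auto
  qed auto
  then show ?thesis using assms(1) by simp
qed

locale monomial_order =
  fixes prec :: "'x::finite pp \<Rightarrow> 'x pp \<Rightarrow> bool" (infix "\<prec>" 50)
  assumes adm: "admissible_order prec"
begin

lemma prec_irrefl: "\<not> t \<prec> t"
  using adm by (auto simp: admissible_order_def irreflp_def)

lemma prec_trans: "s \<prec> t \<Longrightarrow> t \<prec> u \<Longrightarrow> s \<prec> u"
  using adm transpD[of "(\<prec>)" s t u] by (simp add: admissible_order_def)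

lemma prec_total: "s \<noteq> t \<Longrightarrow> s \<prec> t \<or> t \<prec> s"
  using adm by (simp add: admissible_order_def totalp_on_def)

lemma prec_add: "s \<prec> t \<Longrightarrow> s + u \<prec> t + u" "s \<prec> t \<Longrightarrow> u + s \<prec> u + t"
  using adm unfolding admissible_order_def by (metis add.commute)+

lemma prec_cancel: "s + u \<prec> t + u \<Longrightarrow> s \<prec> t"
  using prec_total[of s t] prec_add(1)[of t s u] prec_irrefl prec_trans by metis

lemma not_prec_of_dvd: "term_dvd s t \<Longrightarrow> \<not> t \<prec> s"
proof
  assume "term_dvd s t" "t \<prec> s"
  then obtain u where u: "t = s + u" by (auto simp: term_dvd_def)
  show False
  proof (cases "u = 0")
    case True then show ?thesis using u \<open>t \<prec> s\<close> prec_irrefl by simp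
  next
    case False
    then have "0 \<prec> u" using adm by (auto simp: admissible_order_def)
    then have "s \<prec> t" using prec_add(2)[of 0 u s] u by simp
    then show ?thesis using \<open>t \<prec> s\<close> prec_trans prec_irrefl by blast
  qed
qed

lemma prec_wf: "wfp (\<prec>)"
proof -
  have "\<not> (\<exists>f. \<forall>i. (f (Suc i), f i) \<in> {(s, t). s \<prec> t})"
  proof (rule notI, elim exE)
    fix f assume f: "\<forall>i. (f (Suc i), f i) \<in> {(s, t). s \<prec> t}"
    have d: "f j \<prec> f i" if "i < j" for i j
      using that by (induction rule: less_Suc_induct) (use f prec_trans in auto)
    obtain i j where "i < j" "term_dvd (f i) (f j)" using Dickson by blast
    then show False using d not_prec_of_dvd by blast
  qed
  then show ?thesis by (simp add: wf_iff_no_infinite_down_chain wfp_def)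
qed

section \<open>Leading terms\<close>

text \<open>
  The predicates below also make sense for the zero polynomial, in contrast to the leading term, and
  so no case distinctions are needed when sums cancel. \<open>lead w p\<close> says that \<open>p\<close> is nonzero with
  leading term \<open>w\<close>.
\<close>

definition low :: "'x pp \<Rightarrow> ('x, 'a::zero) mpoly \<Rightarrow> bool" where
  "low w p \<longleftrightarrow> (\<forall>t\<in>Poly_Mapping.keys p. t \<prec> w)"

definition upto :: "'x pp \<Rightarrow> ('x, 'a::zero) mpoly \<Rightarrow> bool" where
  "upto w p \<longleftrightarrow> (\<forall>t\<in>Poly_Mapping.keys p. t = w \<or> t \<prec> w)"

definition lead :: "'x pp \<Rightarrow> ('x, 'a::zero) mpoly \<Rightarrow> bool" where
  "lead w p \<longleftrightarrow> w \<in> Poly_Mapping.keys p \<and> upto w p"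

lemma low_upto: "low w p \<Longrightarrow> upto w p" by (auto simp: low_def upto_def)
lemma lead_upto: "lead w p \<Longrightarrow> upto w p" by (auto simp: lead_def)

lemma lead_nz: "lead w p \<Longrightarrow> p \<noteq> 0" by (auto simp: lead_def)

lemma lead_ltI: "lead w p \<Longrightarrow> lt prec p = w"
  proof -
  assume w: "lead w p"
  show ?thesis
    unfolding lt_def
  proof (rule the_equality)
    show "w \<in> Poly_Mapping.keys p \<and> (\<forall>s\<in>Poly_Mapping.keys p. s \<noteq> w \<longrightarrow> s \<prec> w)"
      using w by (auto simp: lead_def upto_def)
    show "t = w" if "t \<in> Poly_Mapping.keys p \<and> (\<forall>s\<in>Poly_Mapping.keys p. s \<noteq> t \<longrightarrow> s \<prec> t)" for t
      using w that prec_trans[of t w t] prec_irrefl[of t] unfolding lead_def upto_def by metis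
  qed
qed

lemma ex_lead: assumes "p \<noteq> 0" shows "\<exists>w. lead w p"
proof -
  have "finite K \<Longrightarrow> K \<noteq> {} \<Longrightarrow> \<exists>w\<in>K. \<forall>t\<in>K. t = w \<or> t \<prec> w" for K
  proof (induction K rule: finite_ne_induct)
    case (insert a K)
    then obtain w where w: "w \<in> K" "\<forall>t\<in>K. t = w \<or> t \<prec> w" by blast
    then show ?case
    proof (cases "a = w \<or> a \<prec> w")
      case False
      then have "w \<prec> a" using prec_total by blast
      then have "\<forall>t\<in>insert a K. t = a \<or> t \<prec> a" using w(2) prec_trans[of _ w a] by auto
      then show ?thesis by blast
    next
      case True
      then show ?thesis using w by blast
    qed
  qed simp
  then show ?thesis using assms by (simp add: lead_def upto_def) (metis finite_keys keys_eq_empty)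
qed

lemma lead_lt: "p \<noteq> 0 \<Longrightarrow> lead (lt prec p) p"
  using ex_lead lead_ltI by blast

lemma lead_unique: "lead v p \<Longrightarrow> lead w p \<Longrightarrow> v = w"
  using lead_ltI by blast

lemma low_zero [simp]: "low w 0" by (simp add: low_def)

lemma low_add: "low w p \<Longrightarrow> low w q \<Longrightarrow> low w (p + q)"
  using Poly_Mapping.keys_add[of p q] by (auto simp: low_def)

lemma low_diff: "low w p \<Longrightarrow> low w q \<Longrightarrow> low w (p - q)"
  for p q :: "('x, 'a::ab_group_add) mpoly"
proof -
  assume "low w p" "low w q"
  moreover have "Poly_Mapping.keys (p - q) \<subseteq> Poly_Mapping.keys p \<union> Poly_Mapping.keys q"
    by (auto simp: in_keys_iff lookup_minus)
  ultimately show ?thesis by (auto simp: low_def)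
qed

lemma low_lookup: "low w p \<Longrightarrow> Poly_Mapping.lookup p w = 0"
  using prec_irrefl[of w] by (auto simp: low_def simp flip: not_in_keys_iff_lookup_eq_zero)

lemma lead_low: "lead v p \<Longrightarrow> v \<prec> w \<Longrightarrow> low w p"
  using prec_trans[of _ v w] by (auto simp: lead_def low_def upto_def)

lemma upto_low: "upto v p \<Longrightarrow> v \<prec> w \<Longrightarrow> low w p"
  using prec_trans[of _ v w] by (auto simp: low_def upto_def)

lemma lead_diff_low:
  fixes p q :: "('x, 'a::ab_group_add) mpoly"
  assumes "lead w p" "low w q" shows "lead w (p - q)" "lead w (q - p)"
proof -
  have "Poly_Mapping.keys (p - q) \<subseteq> Poly_Mapping.keys p \<union> Poly_Mapping.keys q"
    "Poly_Mapping.keys (q - p) \<subseteq> Poly_Mapping.keys p \<union> Poly_Mapping.keys q"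
    by (auto simp: in_keys_iff lookup_minus)
  then show "lead w (p - q)" "lead w (q - p)"
    using assms low_lookup[OF assms(2)] unfolding lead_def low_def upto_def by (auto simp: in_keys_iff lookup_minus)
qed

lemma low_mult_upto:
  fixes p q :: "('x, 'a::comm_ring_1) mpoly"
  assumes "low v p" "upto w q" shows "low (v + w) (p * q)"
  unfolding low_def
proof
  fix t assume "t \<in> Poly_Mapping.keys (p * q)"
  then obtain a b where t: "t = a + b" "a \<in> Poly_Mapping.keys p" "b \<in> Poly_Mapping.keys q" using keys_mult by blast
  then have "a + b \<prec> v + b" "b = w \<or> v + b \<prec> v + w" using assms prec_add by (auto simp: low_def upto_def)
  then show "t \<prec> v + w" using t(1) prec_trans[of "a + b" "v + b" "v + w"] by auto
qed

lemma upto_mult_low: "upto v p \<Longrightarrow> low w q \<Longrightarrow> low (v + w) (p * q)"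
  for p q :: "('x, 'a::comm_ring_1) mpoly"
  using low_mult_upto[of w q v p] by (simp add: ac_simps)

lemma upto_iff_low: "upto w p \<longleftrightarrow> low w (p - Poly_Mapping.single w (Poly_Mapping.lookup p w))"
  for p :: "('x, 'a::comm_ring_1) mpoly"
  proof -
  have "Poly_Mapping.keys (p - Poly_Mapping.single w (Poly_Mapping.lookup p w)) = Poly_Mapping.keys p - {w}"
    by (auto simp: in_keys_iff lookup_minus lookup_single when_def split: if_splits)
  then show ?thesis using prec_irrefl by (auto simp: upto_def low_def)
qed

lemma upto_single: "upto w (Poly_Mapping.single w c)" by (simp add: upto_def)

lemma upto_mult:
  fixes p q :: "('x, 'a::comm_ring_1) mpoly"
  assumes "upto v p" "upto w q"
  shows "upto (v + w) (p * q)" "Poly_Mapping.lookup (p * q) (v + w) = Poly_Mapping.lookup p v * Poly_Mapping.lookup q w"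
proof -
  define c d where "c = Poly_Mapping.lookup p v" and "d = Poly_Mapping.lookup q w"
  define p' q' where "p' = p - Poly_Mapping.single v c" and "q' = q - Poly_Mapping.single w d"
  have l: "low v p'" "low w q'" using assms upto_iff_low by (auto simp: p'_def q'_def c_def d_def)
  have "p * q = Poly_Mapping.single v c * Poly_Mapping.single w d + (p' * q + Poly_Mapping.single v c * q')"
    by (simp add: p'_def q'_def algebra_simps)
  then have e: "p * q - Poly_Mapping.single (v + w) (c * d) = p' * q + Poly_Mapping.single v c * q'"
    by (simp add: mult_single)
  have "low (v + w) (p' * q + Poly_Mapping.single v c * q')"
    by (intro low_add low_mult_upto upto_mult_low l assms upto_single)
  then have l: "low (v + w) (p * q - Poly_Mapping.single (v + w) (c * d))" by (simp add: e)
  then show "Poly_Mapping.lookup (p * q) (v + w) = c * d" using low_lookup[OF l] by (simp add: lookup_minus)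
  then show "upto (v + w) (p * q)" using l upto_iff_low by metis
qed

lemma lead_mult:
  fixes p q :: "('x, 'a::field) mpoly"
  assumes "lead v p" "lead w q" shows "lead (v + w) (p * q)"
  using assms upto_mult[of v p w q] by (auto simp: lead_def in_keys_iff)

lemma lt_mult:
  fixes p q :: "('x, 'a::field) mpoly"
  assumes "p \<noteq> 0" "q \<noteq> 0"
  shows "p * q \<noteq> 0" "lt prec (p * q) = lt prec p + lt prec q" "lc prec (p * q) = lc prec p * lc prec q"
proof -
  have l: "lead (lt prec p + lt prec q) (p * q)" by (intro lead_mult lead_lt assms)
  show "p * q \<noteq> 0" "lt prec (p * q) = lt prec p + lt prec q" using l lead_nz lead_ltI by blast+
  then show "lc prec (p * q) = lc prec p * lc prec q"
    using upto_mult(2) lead_upto[OF lead_lt[OF assms(1)]] lead_upto[OF lead_lt[OF assms(2)]] by (simp add: lc_def)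
qed

lemma lc_nz: "p \<noteq> 0 \<Longrightarrow> lc prec p \<noteq> 0"
  using lead_lt[of p] by (auto simp: lead_def lc_def in_keys_iff)

text \<open>
  Leading terms can be computed after multiplication by a polynomial with known leading term. The
  elimination below needs this because the natural formula for a new entry appears with an extra
  factor.
\<close>

lemma lead_cancel:
  fixes p q :: "('x, 'a::field) mpoly"
  assumes "lead (v + w) (p * q)" "lead w q" shows "lead v p"
proof -
  have "p \<noteq> 0" using assms(1) by (auto simp: lead_def)
  then obtain u where u: "lead u p" using ex_lead by blast
  then have "u + w = v + w" using lead_unique[OF lead_mult[OF u assms(2)] assms(1)] by blast
  then show ?thesis using u by simp
qed

lemma low_cancel:
  fixes p q :: "('x, 'a::field) mpoly"
  assumes "low (v + w) (p * q)" "lead w q" shows "low v p"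
proof (cases "p = 0")
  case False
  then obtain u where u: "lead u p" using ex_lead by blast
  then have "u + w \<prec> v + w" using lead_mult[OF u assms(2)] assms(1) by (simp add: lead_def low_def)
  then show ?thesis using lead_low[OF u] prec_cancel by blast
qed simp

lemma low_single_mult: "g \<noteq> 0 \<Longrightarrow> t + lt prec g \<prec> w \<Longrightarrow> low w (Poly_Mapping.single t c * g)"
  for g :: "('x, 'a::field) mpoly"
  using upto_mult(1)[OF upto_single lead_upto[OF lead_lt]] upto_low by blast

section \<open>Representations below a term\<close>

text \<open>
  Sums of monomial multiples of elements of \<open>S\<close>, where \<open>D\<close> limits the leading terms of the summands
  and not those of the sum: cancellation between summands is what has to be controlled.
\<close>

inductive representable :: "('x, 'a::field) mpoly set \<Rightarrow> ('x pp \<Rightarrow> bool) \<Rightarrow> ('x, 'a) mpoly \<Rightarrow> bool" for S D where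
  zero: "representable S D 0"
| step: "representable S D p \<Longrightarrow> g \<in> S \<Longrightarrow> D (t + lt prec g) \<Longrightarrow> representable S D (p + Poly_Mapping.single t c * g)"

lemma representable_single: "g \<in> S \<Longrightarrow> D (t + lt prec g) \<Longrightarrow> representable S D (Poly_Mapping.single t c * g)"
  using representable.step[OF representable.zero] by fastforce

lemma representable_add: "representable S D q \<Longrightarrow> representable S D p \<Longrightarrow> representable S D (p + q)"
  by (induction rule: representable.induct) (auto simp: add.assoc[symmetric] intro: representable.step)

lemma representable_shift: "representable S D p \<Longrightarrow> (\<And>s. D s \<Longrightarrow> E (u + s)) \<Longrightarrow> representable S E (Poly_Mapping.single u c * p)"
proof (induction rule: representable.induct)
  case (step p g t d)
  have "representable S E (Poly_Mapping.single u c * p + Poly_Mapping.single (u + t) (c * d) * g)"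
    using step by (intro representable.step) (auto simp: add.assoc)
  then show ?case by (simp add: distrib_left mult.assoc[symmetric] mult_single)
qed (simp add: representable.zero)

lemma representable_scale: "representable S D p \<Longrightarrow> representable S D (Poly_Mapping.single 0 c * p)"
  by (rule representable_shift) auto

lemma representable_minus: "representable S D p \<Longrightarrow> representable S D (- p)"
  using representable_scale[of S D p "-1"] by (simp add: single_uminus)

lemma representable_diff: "representable S D p \<Longrightarrow> representable S D q \<Longrightarrow> representable S D (p - q)"
  using representable_add[OF representable_minus, of S D q p] by simp

lemma representable_mono: "representable S D p \<Longrightarrow> S \<subseteq> T \<Longrightarrow> (\<And>s. D s \<Longrightarrow> E s) \<Longrightarrow> representable T E p"
  by (induction rule: representable.induct) (auto intro: representable.intros)

lemma representable_mult: "g \<in> S \<Longrightarrow> (\<And>t. t \<in> Poly_Mapping.keys h \<Longrightarrow> D (t + lt prec g)) \<Longrightarrow> representable S D (h * g)"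
proof -
  assume g: "g \<in> S" "\<And>t. t \<in> Poly_Mapping.keys h \<Longrightarrow> D (t + lt prec g)"
  have "K \<subseteq> Poly_Mapping.keys h \<Longrightarrow> representable S D (\<Sum>t\<in>K. Poly_Mapping.single t (Poly_Mapping.lookup h t) * g)" if "finite K" for K
    using that
  proof (induction K)
    case (insert t K)
    then show ?case using g by (simp add: representable_add[OF _ representable_single])
  qed (simp add: representable.zero)
  then have "representable S D ((\<Sum>t\<in>Poly_Mapping.keys h. Poly_Mapping.single t (Poly_Mapping.lookup h t)) * g)"
    by (simp add: sum_distrib_right)
  then show ?thesis by (simp flip: sum_monomials)
qed

lemma representable_low: "representable S (\<lambda>s. s \<prec> w) p \<Longrightarrow> 0 \<notin> S \<Longrightarrow> low w p"
proof (induction rule: representable.induct)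
  case (step p g t c)
  then have "g \<noteq> 0" by auto
  then show ?case using step low_add low_single_mult by blast
qed simp

lemma representable_bound: "representable S D p \<Longrightarrow> p = 0 \<or> (\<exists>w. D w \<and> representable S (\<lambda>s. s = w \<or> s \<prec> w) p)"
proof (induction rule: representable.induct)
  case (step p g t c)
  let ?v = "t + lt prec g"
  show ?case
  proof (cases "p = 0")
    case True
    then show ?thesis using step representable_single[of g S "\<lambda>s. s = ?v \<or> s \<prec> ?v" t c] by auto
  next
    case False
    then obtain w where w: "D w" "representable S (\<lambda>s. s = w \<or> s \<prec> w) p" using step by blast
    show ?thesis
    proof (cases "?v = w \<or> ?v \<prec> w")
      case True
      then show ?thesis using representable.step[OF w(2) step(2), of t c] w(1) by blast
    next
      case False
      then have "w \<prec> ?v" using prec_total by blast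
      then have "representable S (\<lambda>s. s = ?v \<or> s \<prec> ?v) p" using representable_mono[OF w(2), of S "\<lambda>s. s = ?v \<or> s \<prec> ?v"] prec_trans[of _ w ?v] by blast
      then show ?thesis using representable.step[OF _ step(2), of "\<lambda>s. s = ?v \<or> s \<prec> ?v" p t c] step(3) by blast
    qed
  qed
qed simp

text \<open>
  The subtraction is the exact division of terms if the leading term of \<open>g\<close> divides \<open>w\<close>.
\<close>

definition monic_at :: "('x, 'a::field) mpoly \<Rightarrow> 'x pp \<Rightarrow> ('x, 'a) mpoly" where
  "monic_at g w = Poly_Mapping.single (w - lt prec g) (inverse (lc prec g)) * g"

lemma monic_at_low:
  assumes "g \<noteq> 0" "term_dvd (lt prec g) w"
  shows "low w (monic_at g w - Poly_Mapping.single w 1)"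
proof -
  note u = upto_mult[OF upto_single lead_upto[OF lead_lt[OF assms(1)]], of "w - lt prec g" "inverse (lc prec g)"]
  have "Poly_Mapping.lookup (monic_at g w) w = 1"
    using u(2) lc_nz[OF assms(1)] by (simp add: term_dvd_diff[OF assms(2)] monic_at_def flip: lc_def)
  moreover have "upto w (monic_at g w)" using u(1) by (simp add: term_dvd_diff[OF assms(2)] monic_at_def)
  ultimately show ?thesis using upto_iff_low by metis
qed

lemma monic_at_shift:
  assumes "term_dvd (lt prec g) w"
  shows "monic_at g (u + w) = Poly_Mapping.single u 1 * monic_at g w"
proof -
  have "u + w - lt prec g = u + (w - lt prec g)"
    using assms by (intro poly_mapping_eqI) (simp add: lookup_add lookup_minus term_dvd_iff)
  then show ?thesis by (simp add: monic_at_def mult.assoc[symmetric] mult_single)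
qed

text \<open>
  At the lcm of the leading terms this says that the S-polynomial has a representation below the lcm
  (\<open>spoly_monic_at\<close>). In terms of \<open>monic_at\<close> the relation is visibly transitive.
\<close>

definition linked :: "('x, 'a::field) mpoly set \<Rightarrow> 'x pp \<Rightarrow> ('x, 'a) mpoly \<Rightarrow> ('x, 'a) mpoly \<Rightarrow> bool" where
  "linked S w f g \<longleftrightarrow> representable S (\<lambda>s. s \<prec> w) (monic_at f w - monic_at g w)"

lemma linked_refl: "linked S w f f" by (simp add: linked_def representable.zero)

lemma linked_sym: "linked S w f g \<Longrightarrow> linked S w g f"
  using representable_minus by (fastforce simp: linked_def)

lemma linked_trans: "linked S w f g \<Longrightarrow> linked S w g h \<Longrightarrow> linked S w f h"
  using representable_add by (fastforce simp: linked_def)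

lemma linked_mono: "linked S w f g \<Longrightarrow> S \<subseteq> T \<Longrightarrow> linked T w f g"
  using representable_mono by (auto simp: linked_def)

lemma linked_shift:
  assumes "linked S v f g" "term_dvd (lt prec f) v" "term_dvd (lt prec g) v" "term_dvd v w"
  shows "linked S w f g"
proof -
  obtain u where w: "w = u + v" using assms(4) by (auto simp: term_dvd_def add.commute)
  have "representable S (\<lambda>s. s \<prec> w) (Poly_Mapping.single u 1 * (monic_at f v - monic_at g v))"
    by (rule representable_shift[OF assms(1)[unfolded linked_def]]) (simp add: w prec_add)
  then show ?thesis by (simp add: linked_def w monic_at_shift assms algebra_simps)
qed

text \<open>
  Modulo representations below \<open>w\<close>, all \<open>monic_at g w\<close> agree, since the pairs are linked at
  their lcm and hence at its multiple \<open>w\<close>. So the summands with leading term \<open>w\<close> collapse into a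
  multiple of a single one of them.
\<close>

lemma representable_upto_cases:
  assumes S: "0 \<notin> S" "\<And>f g. f \<in> S \<Longrightarrow> g \<in> S \<Longrightarrow> linked S (term_lcm (lt prec f) (lt prec g)) f g"
  shows "representable S (\<lambda>s. s = w \<or> s \<prec> w) p \<Longrightarrow> representable S (\<lambda>s. s \<prec> w) p \<or>
    (\<exists>g\<in>S. term_dvd (lt prec g) w \<and> (\<exists>c. representable S (\<lambda>s. s \<prec> w) (p - Poly_Mapping.single 0 c * monic_at g w)))"
proof (induction rule: representable.induct)
  case zero then show ?case by (simp add: representable.zero)
next
  case (step p g t c)
  have g: "g \<noteq> 0" using step S by auto
  show ?case
  proof (cases "t + lt prec g \<prec> w")
    case True
    then have r: "representable S (\<lambda>s. s \<prec> w) (Poly_Mapping.single t c * g)" using representable_single[OF step(2)] by simp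
    from step.IH show ?thesis
    proof
      assume "representable S (\<lambda>s. s \<prec> w) p" then show ?thesis using representable_add[OF r] by simp
    next
      assume "\<exists>g\<in>S. term_dvd (lt prec g) w \<and> (\<exists>c. representable S (\<lambda>s. s \<prec> w) (p - Poly_Mapping.single 0 c * monic_at g w))"
      then obtain h d where h: "h \<in> S" "term_dvd (lt prec h) w" "representable S (\<lambda>s. s \<prec> w) (p - Poly_Mapping.single 0 d * monic_at h w)" by blast
      have "representable S (\<lambda>s. s \<prec> w) (p + Poly_Mapping.single t c * g - Poly_Mapping.single 0 d * monic_at h w)"
        using representable_add[OF r h(3)] by (simp add: algebra_simps)
      then show ?thesis using h by blast
    qed
  next
    case False
    then have w: "w = t + lt prec g" using step by blast
    then have gw: "term_dvd (lt prec g) w" by (auto simp: term_dvd_def add.commute)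
    have e: "Poly_Mapping.single t c * g = Poly_Mapping.single 0 (c * lc prec g) * monic_at g w"
      proof -
      have "c * lc prec g * inverse (lc prec g) = c" using lc_nz[OF g] by simp
      then show ?thesis by (simp only: monic_at_def w mult.assoc[symmetric] mult_single add_diff_cancel_right' add_0)
    qed
    from step.IH show ?thesis
    proof
      assume "representable S (\<lambda>s. s \<prec> w) p"
      then have "representable S (\<lambda>s. s \<prec> w) (p + Poly_Mapping.single t c * g - Poly_Mapping.single 0 (c * lc prec g) * monic_at g w)"
        by (simp add: e)
      then show ?thesis using gw step by blast
    next
      assume "\<exists>g\<in>S. term_dvd (lt prec g) w \<and> (\<exists>c. representable S (\<lambda>s. s \<prec> w) (p - Poly_Mapping.single 0 c * monic_at g w))"
      then obtain h d where h: "h \<in> S" "term_dvd (lt prec h) w" "representable S (\<lambda>s. s \<prec> w) (p - Poly_Mapping.single 0 d * monic_at h w)" by blast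
      have "term_dvd (term_lcm (lt prec g) (lt prec h)) w" using gw h(2) by (simp add: term_dvd_iff term_lcm.rep_eq)
      then have "linked S w g h" using linked_shift[OF S(2)[OF step(2) h(1)] term_dvd_lcm] by blast
      then have "representable S (\<lambda>s. s \<prec> w) (Poly_Mapping.single 0 (c * lc prec g) * (monic_at g w - monic_at h w))"
        unfolding linked_def by (rule representable_scale)
      from representable_add[OF this h(3)]
      have "representable S (\<lambda>s. s \<prec> w) (p + Poly_Mapping.single t c * g - Poly_Mapping.single 0 (d + c * lc prec g) * monic_at h w)"
        unfolding e by (simp add: algebra_simps single_add)
      then show ?thesis using h by blast
    qed
  qed
qed

text \<open>
  Well-founded induction on the bound \<open>w\<close> of the representation. With the collapsed form, either the
  coefficient \<open>c\<close> at \<open>w\<close> is nonzero, and then the leading term is \<open>w\<close>, or the bound can be lowered.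
\<close>

theorem linked_lt_dvd:
  assumes S: "0 \<notin> S" "\<And>f g. f \<in> S \<Longrightarrow> g \<in> S \<Longrightarrow> linked S (term_lcm (lt prec f) (lt prec g)) f g"
    and p: "representable S D p" "p \<noteq> 0"
  shows "\<exists>g\<in>S. term_dvd (lt prec g) (lt prec p)"
proof -
  have "representable S (\<lambda>s. s = w \<or> s \<prec> w) p \<Longrightarrow> ?thesis" for w
  proof (induction w rule: wfp_induct_rule[OF prec_wf])
    case (1 w)
    have low_case: ?thesis if "representable S (\<lambda>s. s \<prec> w) p" using representable_bound[OF that] p 1 by blast
    consider "representable S (\<lambda>s. s \<prec> w) p"
      | g c where "g \<in> S" "term_dvd (lt prec g) w" "representable S (\<lambda>s. s \<prec> w) (p - Poly_Mapping.single 0 c * monic_at g w)"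
      using representable_upto_cases[OF S] 1 by blast
    then show ?case
    proof cases
      case 1 then show ?thesis using low_case by blast
    next
      case (2 g c)
      show ?thesis
      proof (cases "c = 0")
        case True then show ?thesis using 2 low_case by simp
      next
        case False
        have g: "g \<noteq> 0" using 2 S by auto
        have "low w (Poly_Mapping.single 0 c * (monic_at g w - Poly_Mapping.single w 1))"
          using upto_mult_low[OF upto_single[of 0 c] monic_at_low[OF g 2(2)]] by simp
        from low_add[OF representable_low[OF 2(3) S(1)] this] have "low w (p - Poly_Mapping.single w c)"
          by (simp add: algebra_simps mult_single)
        moreover have "lead w (Poly_Mapping.single w c)" using False by (simp add: lead_def upto_def)
        ultimately have "lead w (Poly_Mapping.single w c - (Poly_Mapping.single w c - p))"
          using lead_diff_low(1) low_diff[of w 0 "p - Poly_Mapping.single w c"] by fastforce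
        then have "lt prec p = w" using lead_ltI by simp
        then show ?thesis using 2 by blast
      qed
    qed
  qed
  then show ?thesis using representable_bound[OF p(1)] p(2) by blast
qed

lemma lead_single: "c \<noteq> 0 \<Longrightarrow> lead t (Poly_Mapping.single t c)"
  by (simp add: lead_def upto_def)

section \<open>Reduction to zero\<close>

lemma spoly_monic_at:
  assumes "f \<noteq> 0" "g \<noteq> 0"
  defines "w \<equiv> term_lcm (lt prec f) (lt prec g)"
  shows "spoly prec f g = Poly_Mapping.single 0 (lc prec f * lc prec g) * (monic_at f w - monic_at g w)"
    "low w (spoly prec f g)"
proof -
  have c: "lc prec f * lc prec g * inverse (lc prec f) = lc prec g" "lc prec f * lc prec g * inverse (lc prec g) = lc prec f"
    using lc_nz[OF assms(1)] lc_nz[OF assms(2)] by (simp_all add: field_simps)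
  show e: "spoly prec f g = Poly_Mapping.single 0 (lc prec f * lc prec g) * (monic_at f w - monic_at g w)"
    by (simp add: spoly_def spoly_cofactor_def monic_at_def right_diff_distrib mult_single c w_def
        term_lcm_commute[of "lt prec g"] mult.assoc[symmetric, of "Poly_Mapping.single _ _"])
  have "low w (monic_at f w - monic_at g w)"
    unfolding w_def using low_diff[OF monic_at_low[OF assms(1) term_dvd_lcm(1)] monic_at_low[OF assms(2) term_dvd_lcm(2)]]
    by simp
  then show "low w (spoly prec f g)" unfolding e using upto_mult_low[OF upto_single, of w _ 0] by fastforce
qed

definition reduction ::
    "('x, 'a::field) mpoly list \<Rightarrow> ('x, 'a) mpoly \<Rightarrow> nat \<Rightarrow> (nat \<Rightarrow> ('x, 'a) mpoly) \<Rightarrow> (nat \<Rightarrow> nat) \<Rightarrow> bool" where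
  "reduction G p s q \<nu> \<longleftrightarrow>
     (\<forall>i\<in>{1..s}. is_monomial (q i) \<and> \<nu> i < length G) \<and>
     p = (\<Sum>i=1..s. q i * G ! \<nu> i) \<and>
     (\<forall>i\<in>{1..s}. lt prec (q i) + lt prec (G ! \<nu> i) \<in> Poly_Mapping.keys (p - (\<Sum>j=1..<i. q j * G ! \<nu> j)))"

lemma reductionD:
  assumes r: "reduction G p s q \<nu>"
  shows "i \<in> {1..s} \<Longrightarrow> is_monomial (q i) \<and> \<nu> i < length G" "p = (\<Sum>i=1..s. q i * G ! \<nu> i)"
    "i \<in> {1..s} \<Longrightarrow> lt prec (q i) + lt prec (G ! \<nu> i) \<in> Poly_Mapping.keys (p - (\<Sum>j=1..<i. q j * G ! \<nu> j))"
  proof -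
  note c = r[unfolded reduction_def]
  show "i \<in> {1..s} \<Longrightarrow> is_monomial (q i) \<and> \<nu> i < length G" using c[THEN conjunct1] by (rule bspec)
  show "p = (\<Sum>i=1..s. q i * G ! \<nu> i)" by (rule c[THEN conjunct2, THEN conjunct1])
  show "i \<in> {1..s} \<Longrightarrow> lt prec (q i) + lt prec (G ! \<nu> i) \<in> Poly_Mapping.keys (p - (\<Sum>j=1..<i. q j * G ! \<nu> j))"
    using c[THEN conjunct2, THEN conjunct2] by (rule bspec)
qed

lemma reduces_to_zero_iff: "reduces_to_zero prec G p \<longleftrightarrow> (\<exists>s q \<nu>. reduction G p s q \<nu>)"
proof -
  have "reduction G p 0 undefined undefined" if "p = 0" using that by (simp add: reduction_def)
  then show ?thesis unfolding reduces_to_zero_def reduction_def[symmetric] by blast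
qed

text \<open>
  A step need not cancel the term that it refers to, but the multiple it subtracts has that term as
  leading term. So all remainders and all summands stay below any bound of \<open>p\<close>.
\<close>

lemma reduces_to_zero_representable:
  assumes G: "0 \<notin> set G" and p: "reduces_to_zero prec G p" "low w p"
  shows "representable (set G) (\<lambda>s. s \<prec> w) p"
proof -
  obtain s q \<nu> where "reduction G p s q \<nu>" using p(1) reduces_to_zero_iff by blast
  note q = reductionD[OF this]
  have "k \<le> s \<Longrightarrow> low w (p - (\<Sum>j=1..<Suc k. q j * G ! \<nu> j)) \<and> representable (set G) (\<lambda>s. s \<prec> w) (\<Sum>j=1..<Suc k. q j * G ! \<nu> j)" for k
  proof (induction k)
    case 0 then show ?case using p(2) by (simp add: representable.zero)
  next
    case (Suc k)
    let ?g = "G ! \<nu> (Suc k)"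
    have g: "?g \<in> set G" "?g \<noteq> 0" using q(1)[of "Suc k"] Suc.prems G nth_mem by fastforce+
    obtain t c where t: "q (Suc k) = Poly_Mapping.single t c" "c \<noteq> 0"
      using q(1)[of "Suc k"] Suc.prems by (auto simp: is_monomial_def)
    have "lt prec (q (Suc k)) = t" using t by (intro lead_ltI) (simp add: lead_def upto_def)
    then have "t + lt prec ?g \<prec> w" using q(3)[of "Suc k"] Suc by (auto simp: low_def)
    then have "low w (q (Suc k) * ?g)" "representable (set G) (\<lambda>s. s \<prec> w) (q (Suc k) * ?g)"
      using low_single_mult[OF g(2)] representable_single[OF g(1)] t by simp_all
    moreover have e: "(\<Sum>j=1..<Suc (Suc k). q j * G ! \<nu> j) = (\<Sum>j=1..<Suc k. q j * G ! \<nu> j) + q (Suc k) * ?g" by simp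
    ultimately show ?case
      using Suc low_diff[of w "p - (\<Sum>j=1..<Suc k. q j * G ! \<nu> j)" "q (Suc k) * ?g"]
        representable_add[of "set G" "\<lambda>s. s \<prec> w" "q (Suc k) * ?g"]
      unfolding e by (simp add: diff_diff_eq del: sum.op_ivl_Suc)
  qed
  from this[of s] show ?thesis by (simp add: q(2) atLeastLessThanSuc_atLeastAtMost)
qed

lemma linked_of_reduces_to_zero:
  assumes "0 \<notin> set G" "f \<noteq> 0" "g \<noteq> 0" "reduces_to_zero prec G (spoly prec f g)"
  shows "linked (set G) (term_lcm (lt prec f) (lt prec g)) f g"
proof -
  let ?w = "term_lcm (lt prec f) (lt prec g)" and ?c = "lc prec f * lc prec g"
  have c: "?c \<noteq> 0" using lc_nz[OF assms(2)] lc_nz[OF assms(3)] by simp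
  have "representable (set G) (\<lambda>s. s \<prec> ?w) (Poly_Mapping.single 0 (inverse ?c) * spoly prec f g)"
    by (intro representable_scale reduces_to_zero_representable spoly_monic_at assms)
  moreover have "Poly_Mapping.single 0 (inverse ?c) * spoly prec f g = monic_at f ?w - monic_at g ?w"
    using left_inverse[OF c] by (simp only: spoly_monic_at(1)[OF assms(2,3)] mult.assoc[symmetric] mult_single) simp
  ultimately show ?thesis by (simp add: linked_def)
qed

section \<open>The Extended Criterion\<close>

text \<open>
  With \<open>u'\<close> and \<open>v'\<close> the tails of \<open>u\<close> and \<open>v\<close>, the equation \<open>v * f = u * g\<close> says that the
  difference of the leading parts, which are multiples of \<open>monic_at f w\<close> and \<open>monic_at g w\<close>, equals
  \<open>u' * g - v' * f\<close>. Coprimality of the leading terms makes the bound equal to the lcm.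
\<close>

lemma linked_common_factor:
  assumes f: "f = p * u" "f \<noteq> 0" and g: "g = p * v" "g \<noteq> 0"
    and cop: "\<And>x. Poly_Mapping.lookup (lt prec u) x = 0 \<or> Poly_Mapping.lookup (lt prec v) x = 0"
  shows "linked {f, g} (term_lcm (lt prec f) (lt prec g)) f g"
proof -
  have nz: "p \<noteq> 0" "u \<noteq> 0" "v \<noteq> 0" using f g by auto
  let ?w = "term_lcm (lt prec f) (lt prec g)"
  have ltf: "lt prec f = lt prec p + lt prec u" "lc prec f = lc prec p * lc prec u" using f nz lt_mult by auto
  have ltg: "lt prec g = lt prec p + lt prec v" "lc prec g = lc prec p * lc prec v" using g nz lt_mult by auto
  have w: "?w = lt prec v + lt prec f" "?w = lt prec u + lt prec g"
    using cop by (auto simp: ltf ltg lookup_add term_lcm.rep_eq max_def intro!: poly_mapping_eqI) (metis add_0_right le_add1 le_zero_eq nat_add_left_cancel_le)+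
  define c where "c = inverse (lc prec p * lc prec u * lc prec v)"
  have nzc: "lc prec p \<noteq> 0" "lc prec u \<noteq> 0" "lc prec v \<noteq> 0" using lc_nz nz by auto
  define u' v' where "u' = u - Poly_Mapping.single (lt prec u) (lc prec u)" and "v' = v - Poly_Mapping.single (lt prec v) (lc prec v)"
  have l: "low (lt prec u) u'" "low (lt prec v) v'"
    using lead_upto[OF lead_lt] nz upto_iff_low by (auto simp: u'_def v'_def lc_def)
  have mf: "monic_at f ?w = Poly_Mapping.single 0 c * ((v - v') * f)"
  proof -
    have "c * lc prec v = inverse (lc prec f)" using nzc by (simp add: c_def ltf field_simps)
    then show ?thesis by (simp add: monic_at_def v'_def w(1) mult.assoc[symmetric] mult_single)
  qed
  have mg: "monic_at g ?w = Poly_Mapping.single 0 c * ((u - u') * g)"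
  proof -
    have "c * lc prec u = inverse (lc prec g)" using nzc by (simp add: c_def ltg field_simps)
    then show ?thesis by (simp add: monic_at_def u'_def w(2) mult.assoc[symmetric] mult_single)
  qed
  have "monic_at f ?w - monic_at g ?w = Poly_Mapping.single 0 c * (u' * g - v' * f)"
    proof -
    have "v * f = u * g" unfolding f(1) g(1) by (simp only: ac_simps)
    then show ?thesis unfolding mf mg by (simp add: algebra_simps)
  qed
  moreover have "representable {f, g} (\<lambda>s. s \<prec> ?w) (u' * g)"
  proof (rule representable_mult)
    show "t + lt prec g \<prec> ?w" if "t \<in> Poly_Mapping.keys u'" for t
      unfolding w(2) by (rule prec_add(1)) (use that l in \<open>simp add: low_def\<close>)
  qed simp
  moreover have "representable {f, g} (\<lambda>s. s \<prec> ?w) (v' * f)"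
  proof (rule representable_mult)
    show "t + lt prec f \<prec> ?w" if "t \<in> Poly_Mapping.keys v'" for t
      unfolding w(1) by (rule prec_add(1)) (use that l in \<open>simp add: low_def\<close>)
  qed simp
  ultimately show ?thesis unfolding linked_def by (simp add: representable_scale representable_diff)
qed

text \<open>
  The summands are collected by position. An indexed family is used instead of a set because a
  path may visit the same polynomial more than once.
\<close>

lemma representable_coefficients:
  fixes f :: "nat \<Rightarrow> ('x, 'a::field) mpoly"
  assumes f: "\<And>l. l \<le> n \<Longrightarrow> f l \<noteq> 0"
  shows "representable (f ` {..n}) (\<lambda>s. s \<prec> w) p \<Longrightarrow> \<exists>h. p = (\<Sum>l\<le>n. h l * f l) \<and> (\<forall>l\<le>n. low w (h l * f l))"
proof (induction rule: representable.induct)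
  case zero
  show ?case by (intro exI[of _ "\<lambda>_. 0"]) simp
next
  case (step p g t c)
  then obtain h where h: "p = (\<Sum>l\<le>n. h l * f l)" "\<And>l. l \<le> n \<Longrightarrow> low w (h l * f l)" by blast
  obtain m where m: "m \<le> n" "g = f m" using step by auto
  define d where "d l = (if l = m then Poly_Mapping.single t c else 0)" for l
  have "(\<Sum>l\<le>n. d l * f l) = (\<Sum>l\<le>n. if l = m then Poly_Mapping.single t c * g else 0)"
    by (rule sum.cong) (auto simp: d_def m)
  then have "p + Poly_Mapping.single t c * g = (\<Sum>l\<le>n. (h l + d l) * f l)"
    using m(1) by (simp add: h(1) distrib_right sum.distrib)
  moreover have "low w (d l * f l)" if "l \<le> n" for l
    using low_single_mult[OF f[OF m(1)]] step m by (simp add: d_def)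
  ultimately show ?case using h(2) by (intro exI[of _ "\<lambda>l. h l + d l"]) (auto simp: distrib_right intro!: low_add)
qed

text \<open>
  A link between neighbours, with its representation moved to the other side, is a syzygy whose only
  entries of full weight are those of the two neighbours.
\<close>

lemma syzygy_row:
  fixes f :: "nat \<Rightarrow> ('x, 'a::field) mpoly"
  assumes f: "\<And>l. l \<le> n \<Longrightarrow> f l \<noteq> 0" and j: "j < n"
    and e: "linked (f ` {..n}) w (f j) (f (Suc j))" "term_dvd (lt prec (f j)) w" "term_dvd (lt prec (f (Suc j))) w"
  shows "\<exists>\<rho>. (\<Sum>l\<le>n. \<rho> l * f l) = 0 \<and> lead w (\<rho> j * f j) \<and> lead w (\<rho> (Suc j) * f (Suc j)) \<and>
    (\<forall>l\<le>n. l \<noteq> j \<and> l \<noteq> Suc j \<longrightarrow> low w (\<rho> l * f l))"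
proof -
  obtain h where h: "monic_at (f j) w - monic_at (f (Suc j)) w = (\<Sum>l\<le>n. h l * f l)" "\<And>l. l \<le> n \<Longrightarrow> low w (h l * f l)"
    using representable_coefficients[OF f e(1)[unfolded linked_def]] by blast
  define s where "s l = Poly_Mapping.single (w - lt prec (f l)) (inverse (lc prec (f l)))" for l
  have s: "s l * f l = monic_at (f l) w" for l by (simp add: s_def monic_at_def)
  have ml: "lead w (monic_at (f l) w)" if "l = j \<or> l = Suc j" for l
  proof -
    have "low w (monic_at (f l) w - Poly_Mapping.single w 1)" using that f j e by (intro monic_at_low) auto
    moreover have "lead w (Poly_Mapping.single w (1::'a))" by (simp add: lead_def upto_def)
    ultimately show ?thesis using lead_diff_low(1)[of w "Poly_Mapping.single w 1" "Poly_Mapping.single w 1 - monic_at (f l) w"]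
        low_diff[OF low_zero, of w "monic_at (f l) w - Poly_Mapping.single w 1"] by simp
  qed
  \<comment> \<open>coefficients of the leading part \<open>monic_at (f j) w - monic_at (f (Suc j)) w\<close>\<close>
  define d where "d l = (if l = j then s l else 0) - (if l = Suc j then s l else 0)" for l
  have "(\<Sum>l\<le>n. d l * f l) = (\<Sum>l\<le>n. (if l = j then s l * f l else 0) - (if l = Suc j then s l * f l else 0))"
    by (rule sum.cong) (auto simp: d_def)
  also have "\<dots> = s j * f j - s (Suc j) * f (Suc j)" using j by (simp add: sum_subtractf)
  finally have "(\<Sum>l\<le>n. (d l - h l) * f l) = 0" by (simp add: left_diff_distrib sum_subtractf s h(1))
  moreover have "lead w ((d j - h j) * f j)" using lead_diff_low(1)[OF ml[of j] h(2)[of j]] j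
    by (simp add: left_diff_distrib d_def s)
  moreover have "lead w ((d (Suc j) - h (Suc j)) * f (Suc j))"
  proof -
    have "lead w (0 - monic_at (f (Suc j)) w)" by (rule lead_diff_low(2)[OF ml low_zero]) simp
    from lead_diff_low(1)[OF this h(2)[of "Suc j"]] show ?thesis using j by (simp add: left_diff_distrib d_def s)
  qed
  moreover have "low w ((d l - h l) * f l)" if "l \<le> n" "l \<noteq> j" "l \<noteq> Suc j" for l
    using low_diff[OF low_zero h(2)[OF that(1)]] that by (simp add: d_def)
  ultimately show ?thesis by (intro exI[of _ "\<lambda>l. d l - h l"]) blast
qed

text \<open>
  State of the elimination after the columns \<open>1, ..., m\<close> have been cleared. Row \<open>j\<close> is a syzygy with
  entries \<open>\<rho> j l\<close> and weight \<open>W j\<close>, attained in exactly two columns: in \<open>j\<close> and \<open>j + 1\<close>, except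
  that row \<open>m\<close>, the pivot row of the next step, attains it in column \<open>0\<close> instead of \<open>m\<close>. The last
  clause keeps the degree in \<open>x\<close> of the weight as small as possible.
\<close>

definition echelon_rows ::
    "nat \<Rightarrow> (nat \<Rightarrow> ('x, 'a::field) mpoly) \<Rightarrow> 'x \<Rightarrow> nat \<Rightarrow> (nat \<Rightarrow> nat \<Rightarrow> ('x, 'a) mpoly) \<Rightarrow> (nat \<Rightarrow> 'x pp) \<Rightarrow> bool" where
  "echelon_rows n f x m \<rho> W \<longleftrightarrow> (\<forall>j. m \<le> j \<and> j < n \<longrightarrow>
     (\<Sum>l\<le>n. \<rho> j l * f l) = 0 \<and>
     lead (W j) (\<rho> j (if j = m then 0 else j) * f (if j = m then 0 else j)) \<and>
     lead (W j) (\<rho> j (Suc j) * f (Suc j)) \<and>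
     (\<forall>l\<le>n. l \<noteq> (if j = m then 0 else j) \<and> l \<noteq> Suc j \<longrightarrow> low (W j) (\<rho> j l * f l)) \<and>
     (\<forall>l. 0 < l \<and> l \<le> m \<longrightarrow> \<rho> j l = 0) \<and>
     Poly_Mapping.lookup (W j) x = Poly_Mapping.lookup (lt prec (f (Suc j))) x)"

text \<open>
  Column \<open>m + 1\<close> is cleared with the pivot row \<open>c = \<rho> m\<close> by forming \<open>c (m + 1) * \<rho> j - \<rho> j (m + 1) * c\<close>.
  This multiplies the weights by the leading term of the pivot \<open>c (m + 1)\<close>, which is free of \<open>x\<close>,
  because the weight of the pivot row and the leading term of \<open>f (m + 1)\<close> have the same degree in
  \<open>x\<close>. Thus the invariant on degrees survives.
\<close>

lemma echelon_step:
  fixes f :: "nat \<Rightarrow> ('x, 'a::field) mpoly"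
  assumes f: "\<And>l. l \<le> n \<Longrightarrow> f l \<noteq> 0" and R: "echelon_rows n f x m \<rho> W" and m: "Suc m < n"
  shows "\<exists>\<rho> W. echelon_rows n f x (Suc m) \<rho> W"
proof -
  let ?k = "Suc m"
  define c where "c = \<rho> m"
  define \<rho>' where "\<rho>' j l = c ?k * \<rho> j l - \<rho> j ?k * c l" for j l
  define W' where "W' j = lt prec (c ?k) + W j" for j
  have Rc: "(\<Sum>l\<le>n. c l * f l) = 0" "lead (W m) (c 0 * f 0)" "lead (W m) (c ?k * f ?k)"
    "\<And>l. l \<le> n \<Longrightarrow> l \<noteq> 0 \<Longrightarrow> l \<noteq> ?k \<Longrightarrow> low (W m) (c l * f l)" "\<And>l. 0 < l \<Longrightarrow> l \<le> m \<Longrightarrow> c l = 0"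
    "Poly_Mapping.lookup (W m) x = Poly_Mapping.lookup (lt prec (f ?k)) x"
    using R[unfolded echelon_rows_def, rule_format, of m] m by (auto simp: c_def)
  have fk: "f ?k \<noteq> 0" "c ?k \<noteq> 0" using f m Rc(3) lead_nz by fastforce+
  have ltk: "lead (lt prec (f ?k)) (f ?k)" using lead_lt[OF fk(1)] .
  have Wm: "W m = lt prec (c ?k) + lt prec (f ?k)" using lt_mult(2)[OF fk(2,1)] lead_ltI[OF Rc(3)] by simp
  have x0: "Poly_Mapping.lookup (lt prec (c ?k)) x = 0" using Rc(6) by (simp add: Wm lookup_add)
  have cu: "upto (W m) (c l * f l)" if "l \<le> n" for l
    using that Rc(2,3,4) low_upto lead_upto by (cases "l = 0 \<or> l = ?k") auto
  \<comment> \<open>after multiplication by \<open>f ?k\<close> an entry is a 2 by 2 minor of products with known leading terms\<close>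
  have e: "\<rho>' j l * f l * f ?k = (c ?k * f ?k) * (\<rho> j l * f l) - (\<rho> j ?k * f ?k) * (c l * f l)" for j l
    by (simp add: \<rho>'_def algebra_simps)
  have W: "W' j + lt prec (f ?k) = W m + W j" for j by (simp add: W'_def Wm ac_simps)
  have leadI: "lead (W' j) (\<rho>' j l * f l)"
    if "lead (W m + W j) ((c ?k * f ?k) * (\<rho> j l * f l) - (\<rho> j ?k * f ?k) * (c l * f l))" for j l
    by (rule lead_cancel[OF _ ltk]) (simp only: e W that)
  have lowI: "low (W' j) (\<rho>' j l * f l)"
    if "low (W m + W j) ((c ?k * f ?k) * (\<rho> j l * f l) - (\<rho> j ?k * f ?k) * (c l * f l))" for j l
    by (rule low_cancel[OF _ ltk]) (simp only: e W that)
  have "echelon_rows n f x ?k \<rho>' W'"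
    unfolding echelon_rows_def
  proof (intro allI impI)
    fix j assume j: "?k \<le> j \<and> j < n"
    have Rj: "(\<Sum>l\<le>n. \<rho> j l * f l) = 0" "lead (W j) (\<rho> j j * f j)" "lead (W j) (\<rho> j (Suc j) * f (Suc j))"
      "\<And>l. l \<le> n \<Longrightarrow> l \<noteq> j \<Longrightarrow> l \<noteq> Suc j \<Longrightarrow> low (W j) (\<rho> j l * f l)" "\<And>l. 0 < l \<Longrightarrow> l \<le> m \<Longrightarrow> \<rho> j l = 0"
      "Poly_Mapping.lookup (W j) x = Poly_Mapping.lookup (lt prec (f (Suc j))) x"
      using R[unfolded echelon_rows_def, rule_format, of j] j by auto
    have s: "(\<Sum>l\<le>n. \<rho>' j l * f l) = c ?k * (\<Sum>l\<le>n. \<rho> j l * f l) - \<rho> j ?k * (\<Sum>l\<le>n. c l * f l)"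
      by (simp add: \<rho>'_def left_diff_distrib sum_subtractf sum_distrib_left mult.assoc)
    have first_lead: "lead (W m + W j) ((c ?k * f ?k) * (\<rho> j l * f l))" if "lead (W j) (\<rho> j l * f l)" for l
      using lead_mult[OF Rc(3) that] .
    have first_low: "low (W m + W j) ((c ?k * f ?k) * (\<rho> j l * f l))" if "low (W j) (\<rho> j l * f l)" for l
      using upto_mult_low[OF lead_upto[OF Rc(3)] that] .
    have ku: "upto (W j) (\<rho> j ?k * f ?k)"
      using Rj(2,3) Rj(4)[of ?k] j lead_upto low_upto by (cases "?k = j") auto
    have second_low: "low (W m + W j) ((\<rho> j ?k * f ?k) * (c l * f l))" if "l \<le> n" "j \<noteq> ?k \<or> l \<noteq> 0 \<and> l \<noteq> ?k" for l
    proof (cases "j = ?k")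
      case True
      then show ?thesis using upto_mult_low[OF ku Rc(4)[OF that(1)]] that by (simp add: add.commute)
    next
      case False
      then have "low (W j) (\<rho> j ?k * f ?k)" using Rj(4)[of ?k] j by simp
      then show ?thesis using low_mult_upto[OF _ cu[OF that(1)]] by (simp add: add.commute)
    qed
    have k0: "\<rho>' j ?k = 0" by (simp add: \<rho>'_def)
    show "(\<Sum>l\<le>n. \<rho>' j l * f l) = 0 \<and>
      lead (W' j) (\<rho>' j (if j = ?k then 0 else j) * f (if j = ?k then 0 else j)) \<and>
      lead (W' j) (\<rho>' j (Suc j) * f (Suc j)) \<and>
      (\<forall>l\<le>n. l \<noteq> (if j = ?k then 0 else j) \<and> l \<noteq> Suc j \<longrightarrow> low (W' j) (\<rho>' j l * f l)) \<and>
      (\<forall>l. 0 < l \<and> l \<le> ?k \<longrightarrow> \<rho>' j l = 0) \<and>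
      Poly_Mapping.lookup (W' j) x = Poly_Mapping.lookup (lt prec (f (Suc j))) x"
    proof (intro conjI allI impI)
      show "(\<Sum>l\<le>n. \<rho>' j l * f l) = 0" by (simp add: s Rj(1) Rc(1))
      show "lead (W' j) (\<rho>' j (if j = ?k then 0 else j) * f (if j = ?k then 0 else j))"
      proof (cases "j = ?k")
        case True
        have "lead (W m + W j) ((\<rho> j ?k * f ?k) * (c 0 * f 0))"
          using lead_mult[OF Rj(2) Rc(2)] True by (simp add: add.commute)
        from lead_diff_low(2)[OF this first_low[OF Rj(4)[of 0]]]
        have "lead (W' j) (\<rho>' j 0 * f 0)" using j True by (intro leadI) simp
        then show ?thesis using True by simp
      next
        case False
        have "lead (W' j) (\<rho>' j j * f j)"
          using lead_diff_low(1)[OF first_lead[OF Rj(2)] second_low[of j]] j False by (intro leadI) simp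
        then show ?thesis using False by simp
      qed
      show "lead (W' j) (\<rho>' j (Suc j) * f (Suc j))"
        using lead_diff_low(1)[OF first_lead[OF Rj(3)] second_low[of "Suc j"]] j by (intro leadI) simp
      show "low (W' j) (\<rho>' j l * f l)" if "l \<le> n" "l \<noteq> (if j = ?k then 0 else j) \<and> l \<noteq> Suc j" for l
      proof (cases "l = ?k")
        case True then show ?thesis using k0 by simp
      next
        case False
        have "l \<noteq> j" using that(2) False by (cases "j = ?k") auto
        then show ?thesis using that False
          by (intro lowI low_diff first_low[OF Rj(4)] second_low) (auto split: if_splits)
      qed
      show "\<rho>' j l = 0" if "0 < l \<and> l \<le> ?k" for l
        using that k0 Rj(5)[of l] Rc(5)[of l] by (cases "l = ?k") (auto simp: \<rho>'_def)
      show "Poly_Mapping.lookup (W' j) x = Poly_Mapping.lookup (lt prec (f (Suc j))) x"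
        by (simp add: W'_def lookup_add x0 Rj(6))
    qed
  qed
  then show ?thesis by blast
qed

text \<open>
  At the end a single row remains, with nonzero entries only in the first and last column. Its weight
  has the same degree in \<open>x\<close> as the leading term of \<open>f n\<close>, so nothing is left for \<open>b\<close>. The
  superfluous factors of the elimination may involve the other variables, and this is why the bound
  is obtained for one variable at a time and not for the whole leading term.
\<close>

lemma increasing_syzygy:
  fixes f :: "nat \<Rightarrow> ('x, 'a::field) mpoly"
  assumes f: "\<And>l. l \<le> n \<Longrightarrow> f l \<noteq> 0" and n: "n \<ge> 1"
    and e: "\<And>j. j < n \<Longrightarrow> linked (f ` {..n}) (term_lcm (lt prec (f j)) (lt prec (f (Suc j)))) (f j) (f (Suc j))"
    and inc: "\<And>j. j < n \<Longrightarrow> Poly_Mapping.lookup (lt prec (f j)) x \<le> Poly_Mapping.lookup (lt prec (f (Suc j))) x"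
  shows "\<exists>a b. a * f 0 = b * f n \<and> b \<noteq> 0 \<and> Poly_Mapping.lookup (lt prec b) x = 0"
proof -
  let ?W = "\<lambda>j. term_lcm (lt prec (f j)) (lt prec (f (Suc j)))"
  define Q where "Q j \<rho> \<longleftrightarrow> (\<Sum>l\<le>n. \<rho> l * f l) = 0 \<and> lead (?W j) (\<rho> j * f j) \<and> lead (?W j) (\<rho> (Suc j) * f (Suc j)) \<and>
    (\<forall>l\<le>n. l \<noteq> j \<and> l \<noteq> Suc j \<longrightarrow> low (?W j) (\<rho> l * f l))" for j \<rho>
  have "\<exists>\<rho>. Q j \<rho>" if "j < n" for j
    unfolding Q_def by (rule syzygy_row[OF f that e[OF that] term_dvd_lcm])
  then obtain \<rho> where \<rho>: "\<And>j. j < n \<Longrightarrow> Q j (\<rho> j)" by metis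
  have "echelon_rows n f x 0 \<rho> ?W"
    using \<rho> inc by (simp add: Q_def echelon_rows_def term_lcm.rep_eq max_absorb2)
  then have "m < n \<Longrightarrow> \<exists>\<rho> W. echelon_rows n f x m \<rho> W" for m
    proof (induction m)
    case 0 then show ?case by blast
  next
    case (Suc m)
    then obtain \<rho> W where "echelon_rows n f x m \<rho> W" using Suc_lessD by blast
    from echelon_step[OF _ this Suc.prems(1)] f show ?case by simp
  qed
  then obtain \<rho> W where "echelon_rows n f x (n - 1) \<rho> W" using n by force
  from this[unfolded echelon_rows_def, rule_format, of "n - 1"] n
  have r: "(\<Sum>l\<le>n. \<rho> (n-1) l * f l) = 0" "lead (W (n-1)) (\<rho> (n-1) n * f n)" "\<And>l. 0 < l \<Longrightarrow> l < n \<Longrightarrow> \<rho> (n-1) l = 0"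
    "Poly_Mapping.lookup (W (n-1)) x = Poly_Mapping.lookup (lt prec (f n)) x"
    by auto
  have "\<rho> (n-1) 0 * f 0 + \<rho> (n-1) n * f n = 0"
    using sum_first_last[OF n, of "\<lambda>l. \<rho> (n-1) l * f l"] r(1,3) by simp
  then have "(- \<rho> (n-1) 0) * f 0 = \<rho> (n-1) n * f n" by (simp add: add_eq_0_iff)
  moreover have nz: "\<rho> (n-1) n \<noteq> 0" using lead_nz[OF r(2)] by auto
  moreover have "Poly_Mapping.lookup (lt prec (\<rho> (n-1) n)) x = 0"
    using lead_ltI[OF r(2)] lt_mult(2)[OF nz f[of n]] r(4) by (simp add: lookup_add)
  ultimately show ?thesis by blast
qed

lemma lt_dvd_lookup: "b \<noteq> 0 \<Longrightarrow> u dvd b \<Longrightarrow> Poly_Mapping.lookup (lt prec u) x \<le> Poly_Mapping.lookup (lt prec b) x"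
  for u b :: "('x, 'a::field) mpoly"
  proof -
  assume b: "b \<noteq> 0" "u dvd b"
  obtain k where k: "b = u * k" using b(2) unfolding dvd_def by blast
  then have "u \<noteq> 0" "k \<noteq> 0" using b(1) by auto
  then have "lt prec b = lt prec u + lt prec k" unfolding k by (rule lt_mult(2))
  then show ?thesis by (simp add: lookup_add)
qed

text \<open>
  Let \<open>f 0 = p * u\<close> and \<open>f n = p * v\<close> with \<open>u\<close> and \<open>v\<close> without common factor. For a variable with
  monotonic exponents, the syzygies along the path yield \<open>u * a = v * b\<close> where one of \<open>a\<close> and \<open>b\<close> has
  a leading term free of that variable. As \<open>u\<close> divides \<open>b\<close> and \<open>v\<close> divides \<open>a\<close>, one of \<open>u\<close>
  and \<open>v\<close> inherits this.
\<close>

theorem linked_extended_criterion: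
  fixes f :: "nat \<Rightarrow> ('x, 'a::field) mpoly"
  assumes f: "\<And>l. l \<le> n \<Longrightarrow> f l \<noteq> 0" and n: "n \<ge> 1"
    and e: "\<And>j. j < n \<Longrightarrow> linked (f ` {..n}) (term_lcm (lt prec (f j)) (lt prec (f (Suc j)))) (f j) (f (Suc j))"
    and mono: "\<And>x. Poly_Mapping.lookup (term_gcd (lt prec (f 0)) (lt prec (f n))) x = 0 \<or>
      (\<forall>j<n. Poly_Mapping.lookup (lt prec (f j)) x \<le> Poly_Mapping.lookup (lt prec (f (Suc j))) x) \<or>
      (\<forall>j<n. Poly_Mapping.lookup (lt prec (f j)) x \<ge> Poly_Mapping.lookup (lt prec (f (Suc j))) x)"
  shows "linked {f 0, f n} (term_lcm (lt prec (f 0)) (lt prec (f n))) (f 0) (f n)"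
proof -
  have f0: "f 0 \<noteq> 0" "f n \<noteq> 0" using f by auto
  obtain p u v where puv: "f 0 = p * u" "f n = p * v" "\<And>a b. u * a = v * b \<Longrightarrow> u dvd b"
    using mpoly_cofactors[OF f0(1), of "f n"] by blast
  have nz: "p \<noteq> 0" "u \<noteq> 0" "v \<noteq> 0" using f0 puv by auto
  have canc: "u * a = v * b" if "a * f 0 = b * f n" for a b
  proof -
    have "p * (u * a - v * b) = 0" using that by (simp add: puv algebra_simps)
    then show ?thesis using lt_mult(1)[OF nz(1), of "u * a - v * b"] by auto
  qed
  have "Poly_Mapping.lookup (lt prec u) x = 0 \<or> Poly_Mapping.lookup (lt prec v) x = 0" for x
    using mono[of x]
  proof (elim disjE)
    assume "Poly_Mapping.lookup (term_gcd (lt prec (f 0)) (lt prec (f n))) x = 0"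
    then show ?thesis by (auto simp: term_gcd.rep_eq puv lt_mult(2) nz lookup_add min_def split: if_splits)
  next
    assume "\<forall>j<n. Poly_Mapping.lookup (lt prec (f j)) x \<le> Poly_Mapping.lookup (lt prec (f (Suc j))) x"
    then obtain a b where ab: "a * f 0 = b * f n" "b \<noteq> 0" "Poly_Mapping.lookup (lt prec b) x = 0"
      using increasing_syzygy[OF f n e] by blast
    then show ?thesis using lt_dvd_lookup[OF ab(2) puv(3)[OF canc[OF ab(1)]], of x] by simp
  next
    assume dec: "\<forall>j<n. Poly_Mapping.lookup (lt prec (f j)) x \<ge> Poly_Mapping.lookup (lt prec (f (Suc j))) x"
    \<comment> \<open>along the reversed path the exponents increase\<close>
    let ?f = "\<lambda>l. f (n - l)"
    have im: "?f ` {..n} = f ` {..n}"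
    proof -
      have "(\<lambda>l. n - l) ` {..n} = {..n}" proof (intro set_eqI iffI)
        show "l \<in> (\<lambda>l. n - l) ` {..n}" if "l \<in> {..n}" for l using that by (intro image_eqI[of _ _ "n - l"]) auto
      qed auto
      then show ?thesis by (metis image_image)
    qed
    have "\<exists>a b. a * ?f 0 = b * ?f n \<and> b \<noteq> 0 \<and> Poly_Mapping.lookup (lt prec b) x = 0"
    proof (rule increasing_syzygy[OF _ n])
      fix j assume j: "j < n"
      then have s: "n - j = Suc (n - Suc j)" "n - Suc j < n" by auto
      show "linked (?f ` {..n}) (term_lcm (lt prec (?f j)) (lt prec (?f (Suc j)))) (?f j) (?f (Suc j))"
        unfolding im using linked_sym[OF e[OF s(2)]] by (simp add: s(1) term_lcm_commute)
      show "Poly_Mapping.lookup (lt prec (?f j)) x \<le> Poly_Mapping.lookup (lt prec (?f (Suc j))) x"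
        using dec s by simp
    qed (use f in simp)
    then obtain a b where ab: "a * f n = b * f 0" "b \<noteq> 0" "Poly_Mapping.lookup (lt prec b) x = 0" by auto
    have ub: "u * b = v * a" using canc[of b a] ab(1) by simp
    then obtain a' where a': "a = u * a'" using puv(3) by (metis dvdE)
    have "u * (b - v * a') = 0" using ub by (simp add: a' algebra_simps)
    then have "b = v * a'" using lt_mult(1)[OF nz(2), of "b - v * a'"] by auto
    then show ?thesis using lt_dvd_lookup[OF ab(2), of v x] ab(3) by simp
  qed
  then show ?thesis using linked_common_factor[OF puv(1) f0(1) puv(2) f0(2)] by blast
qed

lemma linked_coprime:
  assumes "f \<noteq> 0" "g \<noteq> 0" "relatively_prime (lt prec f) (lt prec g)"
  shows "linked {f, g} (term_lcm (lt prec f) (lt prec g)) f g"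
proof (rule linked_common_factor[of f 1 f g g])
  fix x
  have "Poly_Mapping.lookup (term_gcd (lt prec f) (lt prec g)) x = 0" using assms(3) by (simp add: relatively_prime_def)
  then show "Poly_Mapping.lookup (lt prec f) x = 0 \<or> Poly_Mapping.lookup (lt prec g) x = 0"
    by (auto simp: term_gcd.rep_eq min_def split: if_splits)
qed (use assms in auto)

lemma linked_chain:
  "(\<And>l. l < n \<Longrightarrow> linked S w (f l) (f (Suc l))) \<Longrightarrow> linked S w (f 0) (f n)"
  proof (induction n)
  case 0 show ?case by (rule linked_refl)
next
  case (Suc n)
  then have "linked S w (f 0) (f n)" by simp
  then show ?case by (rule linked_trans) (simp add: Suc.prems)
qed

section \<open>Groebner bases\<close>

lemma reduces_to_zero_step:
  assumes "is_monomial q" "\<nu> < length G" "lt prec q + lt prec (G ! \<nu>) \<in> Poly_Mapping.keys p"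
    "reduces_to_zero prec G (p - q * G ! \<nu>)"
  shows "reduces_to_zero prec G p"
proof -
  obtain s q' \<nu>' where "reduction G (p - q * G ! \<nu>) s q' \<nu>'" using assms(4) reduces_to_zero_iff by blast
  note r = reductionD[OF this]
  \<comment> \<open>the given step is put in front, which shifts the indices of the remaining steps by one\<close>
  define Q N where "Q i = (if i = 1 then q else q' (i - 1))" and "N i = (if i = 1 then \<nu> else \<nu>' (i - 1))" for i :: nat
  have sum: "(\<Sum>j=1..<Suc (Suc k). Q j * G ! N j) = q * G ! \<nu> + (\<Sum>j=1..<Suc k. q' j * G ! \<nu>' j)" for k
  proof -
    have "(\<Sum>j=1..<Suc (Suc k). Q j * G ! N j) = Q 1 * G ! N 1 + (\<Sum>j=Suc 1..<Suc (Suc k). Q j * G ! N j)"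
      by (subst sum.atLeast_Suc_lessThan) auto
    also have "(\<Sum>j=Suc 1..<Suc (Suc k). Q j * G ! N j) = (\<Sum>j=1..<Suc k. q' j * G ! \<nu>' j)"
      unfolding sum.shift_bounds_Suc_ivl by (rule sum.cong) (auto simp: Q_def N_def)
    finally show ?thesis by (simp add: Q_def N_def)
  qed
  have cases: "i = 1 \<or> (\<exists>k. i = Suc (Suc k) \<and> Suc k \<in> {1..s})" if "i \<in> {1..Suc s}" for i
    using that by (cases i; cases "i - 1") auto
  have "is_monomial (Q i) \<and> N i < length G" if "i \<in> {1..Suc s}" for i
    using cases[OF that] r(1) assms(1,2) by (auto simp: Q_def N_def)
  moreover have "p = (\<Sum>i=1..Suc s. Q i * G ! N i)"
    using sum[of s] r(2) by (simp only: atLeastLessThanSuc_atLeastAtMost) (simp add: algebra_simps)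
  moreover have "lt prec (Q i) + lt prec (G ! N i) \<in> Poly_Mapping.keys (p - (\<Sum>j=1..<i. Q j * G ! N j))"
    if "i \<in> {1..Suc s}" for i
    using cases[OF that]
  proof (elim disjE exE conjE)
    assume "i = 1" then show ?thesis using assms(3) by (simp add: Q_def N_def)
  next
    fix k assume k: "i = Suc (Suc k)" "Suc k \<in> {1..s}"
    show ?thesis using r(3)[OF k(2)] unfolding k(1) sum by (simp add: Q_def N_def diff_diff_eq del: sum.op_ivl_Suc)
  qed
  ultimately have "reduction G p (Suc s) Q N" unfolding reduction_def by simp
  then show ?thesis using reduces_to_zero_iff by blast
qed

text \<open>
  Subtracting the multiple of a basis element that cancels the leading term stays in the ideal and
  lowers the leading term.
\<close>

lemma groebner_basis_reduces:
  assumes G: "is_groebner_basis prec G" "0 \<notin> set G"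
  shows "p \<in> module.span (*) (set G) \<Longrightarrow> reduces_to_zero prec G p"
proof -
  have red: "upto w p \<Longrightarrow> p \<in> module.span (*) (set G) \<Longrightarrow> reduces_to_zero prec G p" for w p
  proof (induction w arbitrary: p rule: wfp_induct_rule[OF prec_wf])
    case (1 w)
    show ?case
    proof (cases "p = 0")
      case True then show ?thesis by (simp add: reduces_to_zero_def)
    next
      case p: False
      then obtain g where g: "g \<in> set G" "term_dvd (lt prec g) (lt prec p)" using G(1) 1 by (auto simp: is_groebner_basis_def)
      then obtain \<nu> where \<nu>: "\<nu> < length G" "g = G ! \<nu>" by (metis in_set_conv_nth)
      have g0: "g \<noteq> 0" using g G by auto
      define q where "q = Poly_Mapping.single (lt prec p - lt prec g) (lc prec p * inverse (lc prec g))"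
      have c: "lc prec p * inverse (lc prec g) \<noteq> 0" using lc_nz[OF p] lc_nz[OF g0] by simp
      then have q: "is_monomial q" "q \<noteq> 0" "lt prec q = lt prec p - lt prec g"
        unfolding q_def is_monomial_def using lead_single[OF c] lead_nz lead_ltI by blast+
      have e: "q * g = Poly_Mapping.single 0 (lc prec p) * monic_at g (lt prec p)"
        by (simp add: q_def monic_at_def mult.assoc[symmetric] mult_single)
      have "low (lt prec p) (Poly_Mapping.single 0 (lc prec p) * (monic_at g (lt prec p) - Poly_Mapping.single (lt prec p) 1))"
        using upto_mult_low[OF upto_single monic_at_low[OF g0 g(2)], of 0] by simp
      then have "low (lt prec p) (q * g - Poly_Mapping.single (lt prec p) (lc prec p))"
        by (simp add: e right_diff_distrib mult_single)
      from low_diff[OF _ this, of "p - Poly_Mapping.single (lt prec p) (lc prec p)"]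
      have "low (lt prec p) (p - q * g)" using lead_upto[OF lead_lt[OF p]] upto_iff_low[of "lt prec p" p] by (simp add: lc_def)
      then have low': "low (lt prec p) (p - q * G ! \<nu>)" using \<nu>(2) by simp
      have wp: "lt prec p = w \<or> lt prec p \<prec> w" using 1 lead_lt[OF p] by (auto simp: upto_def lead_def)
      have sp: "p - q * g \<in> module.span (*) (set G)"
        using 1 g(1) module.span_diff[OF module_times] module.span_scale[OF module_times] module.span_base[OF module_times] by blast
      have "reduces_to_zero prec G (p - q * G ! \<nu>)"
      proof (cases "p - q * G ! \<nu> = 0")
        case True then show ?thesis by (simp add: reduces_to_zero_def)
      next
        case False
        then have l: "lead (lt prec (p - q * G ! \<nu>)) (p - q * G ! \<nu>)" by (rule lead_lt)
        then have "lt prec (p - q * G ! \<nu>) \<prec> lt prec p" using low' by (simp add: low_def lead_def)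
        then have "lt prec (p - q * G ! \<nu>) \<prec> w" using wp prec_trans by metis
        from 1(1)[OF this lead_upto[OF l]] show ?thesis using sp \<nu>(2) by simp
      qed
      moreover have "lt prec q + lt prec (G ! \<nu>) \<in> Poly_Mapping.keys p"
        using lead_lt[OF p] \<nu> q(3) term_dvd_diff[OF g(2)] by (simp add: lead_def)
      ultimately show ?thesis using reduces_to_zero_step[OF q(1) \<nu>(1)] \<nu>(2) by blast
    qed
  qed
  assume "p \<in> module.span (*) (set G)"
  then show ?thesis using red[OF lead_upto[OF lead_lt]] by (cases "p = 0") (auto simp: reduces_to_zero_def)
qed

lemma representable_span:
  fixes S :: "('x, 'a::field) mpoly set"
  assumes "p \<in> module.span (*) S" shows "representable S (\<lambda>_. True) p"
  using module.span_induct_alt[OF module_times assms, of "representable S (\<lambda>_. True)"]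
  by (auto intro: representable.zero representable_add representable_mult)

lemma spoly_span:
  fixes S :: "('x, 'a::field) mpoly set"
  assumes "f \<in> S" "g \<in> S" shows "spoly prec f g \<in> module.span (*) S"
  unfolding spoly_def
  by (intro module.span_diff[OF module_times] module.span_scale[OF module_times] module.span_base[OF module_times] assms)

lemma linked_path:
  fixes G :: "('x, 'a::field) mpoly list"
  assumes G: "\<And>i. i < length G \<Longrightarrow> G ! i \<noteq> 0" and ks: "ks \<noteq> []" "set ks \<subseteq> {..<length G}"
    and dvd: "\<forall>l<length ks. term_dvd (lt prec (G ! (ks ! l))) w"
    and red: "\<forall>l. l + 1 < length ks \<longrightarrow> reduces_to_zero prec G (spoly prec (G ! (ks ! l)) (G ! (ks ! (l + 1))))"
  shows "linked (set G) w (G ! hd ks) (G ! last ks)"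
proof -
  have G0: "0 \<notin> set G" using G by (metis in_set_conv_nth)
  have nz: "G ! (ks ! l) \<noteq> 0" if "l < length ks" for l
    using G ks(2) nth_mem[OF that] by blast
  have "linked (set G) w (G ! (ks ! 0)) (G ! (ks ! (length ks - 1)))"
  proof (rule linked_chain[where f = "\<lambda>l. G ! (ks ! l)"])
    fix l assume "l < length ks - 1"
    then have l: "l < length ks" "Suc l < length ks" by auto
    let ?w = "term_lcm (lt prec (G ! (ks ! l))) (lt prec (G ! (ks ! Suc l)))"
    have "reduces_to_zero prec G (spoly prec (G ! (ks ! l)) (G ! (ks ! Suc l)))" using red l by simp
    then have e: "linked (set G) ?w (G ! (ks ! l)) (G ! (ks ! Suc l))"
      by (rule linked_of_reduces_to_zero[OF G0 nz[OF l(1)] nz[OF l(2)]])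
    have "term_dvd ?w w" using dvd l by (auto simp: term_dvd_iff term_lcm.rep_eq)
    then show "linked (set G) w (G ! (ks ! l)) (G ! (ks ! Suc l))"
      by (rule linked_shift[OF e term_dvd_lcm])
  qed
  then show ?thesis using ks(1) by (simp add: hd_conv_nth last_conv_nth)
qed

lemma linked_extended_path:
  fixes G :: "('x, 'a::field) mpoly list"
  assumes G: "\<And>i. i < length G \<Longrightarrow> G ! i \<noteq> 0" and ks: "ks \<noteq> []" "set ks \<subseteq> {..<length G}" "hd ks \<noteq> last ks"
    and ext: "extended_criterion (map (\<lambda>k. lt prec (G ! k)) ks)"
    and red: "\<forall>l. l + 1 < length ks \<longrightarrow>
      reduces_to_zero prec (map (\<lambda>k. G ! k) ks) (spoly prec (G ! (ks ! l)) (G ! (ks ! (l + 1))))"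
  shows "linked (set G) (term_lcm (lt prec (G ! hd ks)) (lt prec (G ! last ks))) (G ! hd ks) (G ! last ks)"
proof -
  let ?f = "\<lambda>l. G ! (ks ! l)" and ?n = "length ks - 1"
  have nz: "?f l \<noteq> 0" if "l \<le> ?n" for l
  proof -
    have "l < length ks" using that ks(1) by (cases ks) auto
    then show ?thesis using G ks(2) nth_mem by blast
  qed
  have n: "?n \<ge> 1" using ks(1,3) by (cases ks) (auto simp: Suc_le_eq)
  have ends: "?f 0 = G ! hd ks" "?f ?n = G ! last ks" using ks(1) by (simp_all add: hd_conv_nth last_conv_nth)
  have "set ks = (!) ks ` {..?n}"
    using ks(1) by (auto simp: set_conv_nth image_iff) (metis Suc_pred atMost_iff length_greater_0_conv less_Suc_eq_le)
  then have S: "set (map (\<lambda>k. G ! k) ks) = ?f ` {..?n}" by auto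
  have S0: "0 \<notin> set (map (\<lambda>k. G ! k) ks)" unfolding S using nz by force
  have "linked {?f 0, ?f ?n} (term_lcm (lt prec (?f 0)) (lt prec (?f ?n))) (?f 0) (?f ?n)"
  proof (rule linked_extended_criterion[OF nz n])
    fix j assume j: "j < ?n"
    have "reduces_to_zero prec (map (\<lambda>k. G ! k) ks) (spoly prec (?f j) (?f (Suc j)))" using red j by simp
    then show "linked (?f ` {..?n}) (term_lcm (lt prec (?f j)) (lt prec (?f (Suc j)))) (?f j) (?f (Suc j))"
      using linked_of_reduces_to_zero[OF S0 nz[of j] nz[of "Suc j"]] j by (simp only: S)
  next
    fix x
    let ?ds = "map (\<lambda>t. Poly_Mapping.lookup t x) (map (\<lambda>k. lt prec (G ! k)) ks)"
    have nth: "?ds ! l = Poly_Mapping.lookup (lt prec (?f l)) x" if "l < length ks" for l using that by simp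
    have "Poly_Mapping.lookup (term_gcd (hd (map (\<lambda>k. lt prec (G ! k)) ks)) (last (map (\<lambda>k. lt prec (G ! k)) ks))) x = 0 \<or>
      sorted_wrt (\<le>) ?ds \<or> sorted_wrt (\<ge>) ?ds"
      using ext unfolding extended_criterion_def by blast
    then show "Poly_Mapping.lookup (term_gcd (lt prec (?f 0)) (lt prec (?f ?n))) x = 0 \<or>
      (\<forall>j<?n. Poly_Mapping.lookup (lt prec (?f j)) x \<le> Poly_Mapping.lookup (lt prec (?f (Suc j))) x) \<or>
      (\<forall>j<?n. Poly_Mapping.lookup (lt prec (?f j)) x \<ge> Poly_Mapping.lookup (lt prec (?f (Suc j))) x)"
    proof (elim disjE)
      assume "Poly_Mapping.lookup (term_gcd (hd (map (\<lambda>k. lt prec (G ! k)) ks)) (last (map (\<lambda>k. lt prec (G ! k)) ks))) x = 0"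
      then show ?thesis unfolding ends using ks(1) by (simp add: hd_map last_map)
    next
      assume "sorted_wrt (\<le>) ?ds"
      then show ?thesis using sorted_wrt_nth_less[of "(\<le>)" ?ds] by (auto simp: nth)
    next
      assume "sorted_wrt (\<ge>) ?ds"
      then show ?thesis using sorted_wrt_nth_less[of "(\<ge>)" ?ds] by (auto simp: nth)
    qed
  qed
  then have "linked {G ! hd ks, G ! last ks} (term_lcm (lt prec (G ! hd ks)) (lt prec (G ! last ks))) (G ! hd ks) (G ! last ks)"
    unfolding ends .
  moreover have "G ! hd ks \<in> set G" "G ! last ks \<in> set G"
    using ks(2) hd_in_set[OF ks(1)] last_in_set[OF ks(1)] by auto
  ultimately show ?thesis by (metis linked_mono empty_subsetI insert_subset)
qed

end

theorem mainTheorem1: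
  fixes prec :: "('x::finite \<Rightarrow>\<^sub>0 nat) \<Rightarrow> ('x \<Rightarrow>\<^sub>0 nat) \<Rightarrow> bool"
    and G :: "(('x \<Rightarrow>\<^sub>0 nat) \<Rightarrow>\<^sub>0 'a::field) list"
  assumes "admissible_order prec"
    and "length G \<ge> 1"
    and "\<And>i. i < length G \<Longrightarrow> G ! i \<noteq> 0"
  shows "is_groebner_basis prec G \<longleftrightarrow>
    (\<forall>i j. i < j \<and> j < length G \<longrightarrow>
       reduces_to_zero prec G (spoly prec (G ! i) (G ! j)) \<or>
       relatively_prime (lt prec (G ! i)) (lt prec (G ! j)) \<or>
       (\<exists>ks. ks \<noteq> [] \<and> set ks \<subseteq> {..<length G} \<and> hd ks = i \<and> last ks = j \<and>
          (\<forall>l<length ks. term_dvd (lt prec (G ! (ks ! l)))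
                                  (term_lcm (lt prec (G ! i)) (lt prec (G ! j)))) \<and>
          (\<forall>l. l + 1 < length ks \<longrightarrow>
             reduces_to_zero prec G (spoly prec (G ! (ks ! l)) (G ! (ks ! (l + 1)))))) \<or>
       (\<exists>ks. ks \<noteq> [] \<and> set ks \<subseteq> {..<length G} \<and> hd ks = i \<and> last ks = j \<and>
          extended_criterion (map (\<lambda>k. lt prec (G ! k)) ks) \<and>
          (\<forall>l. l + 1 < length ks \<longrightarrow>
             reduces_to_zero prec (map (\<lambda>k. G ! k) ks)
               (spoly prec (G ! (ks ! l)) (G ! (ks ! (l + 1)))))))"
    (is "_ \<longleftrightarrow> (\<forall>i j. i < j \<and> j < length G \<longrightarrow> ?B i j)")
proof
  interpret monomial_order prec by unfold_locales (rule assms(1))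
  have G0: "0 \<notin> set G" using assms(3) by (metis in_set_conv_nth)
  {
    assume "is_groebner_basis prec G"
    then show "\<forall>i j. i < j \<and> j < length G \<longrightarrow> ?B i j"
      using groebner_basis_reduces[OF _ G0 spoly_span] by simp
  next
    assume B: "\<forall>i j. i < j \<and> j < length G \<longrightarrow> ?B i j"
    have lt: "linked (set G) (term_lcm (lt prec (G ! i)) (lt prec (G ! j))) (G ! i) (G ! j)"
      if ij: "i < j" "j < length G" for i j
    proof -
      have nz: "G ! i \<noteq> 0" "G ! j \<noteq> 0" using assms(3) ij by simp_all
      have "?B i j" using B ij by blast
      then show ?thesis
      proof (elim disjE exE conjE)
        assume "reduces_to_zero prec G (spoly prec (G ! i) (G ! j))"
        then show ?thesis by (rule linked_of_reduces_to_zero[OF G0 nz])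
      next
        assume "relatively_prime (lt prec (G ! i)) (lt prec (G ! j))"
        then show ?thesis by (rule linked_mono[OF linked_coprime[OF nz]]) (use ij in simp)
      next
        fix ks
        assume ks: "ks \<noteq> []" "set ks \<subseteq> {..<length G}" "hd ks = i" "last ks = j"
          and "\<forall>l<length ks. term_dvd (lt prec (G ! (ks ! l))) (term_lcm (lt prec (G ! i)) (lt prec (G ! j)))"
            "\<forall>l. l + 1 < length ks \<longrightarrow> reduces_to_zero prec G (spoly prec (G ! (ks ! l)) (G ! (ks ! (l + 1))))"
        then show ?thesis using linked_path[OF assms(3)] by metis
      next
        fix ks
        assume ks: "ks \<noteq> []" "set ks \<subseteq> {..<length G}" "hd ks = i" "last ks = j"
          and "extended_criterion (map (\<lambda>k. lt prec (G ! k)) ks)"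
            "\<forall>l. l + 1 < length ks \<longrightarrow>
              reduces_to_zero prec (map (\<lambda>k. G ! k) ks) (spoly prec (G ! (ks ! l)) (G ! (ks ! (l + 1))))"
        then show ?thesis using linked_extended_path[OF assms(3) ks(1,2)] ij by auto
      qed
    qed
    have "linked (set G) (term_lcm (lt prec f) (lt prec g)) f g" if fg: "f \<in> set G" "g \<in> set G" for f g
    proof -
      obtain i j where ij: "i < length G" "f = G ! i" "j < length G" "g = G ! j" using fg by (metis in_set_conv_nth)
      consider "i < j" | "i = j" | "j < i" by linarith
      then show ?thesis
      proof cases
        case 1 then show ?thesis using lt ij by simp
      next
        case 2 then show ?thesis using ij by (simp add: linked_refl)
      next
        case 3
        then have "linked (set G) (term_lcm (lt prec g) (lt prec f)) g f" using lt ij by simp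
        then show ?thesis using linked_sym term_lcm_commute by metis
      qed
    qed
    then show "is_groebner_basis prec G"
      using linked_lt_dvd[OF G0 _ representable_span] unfolding is_groebner_basis_def by blast
  }
qed

end
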